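(* Let $\Phi:\mathbb{C}\to\mathbb{C}$ be an entire function of exponential type with $|\Phi(0)|=1$ and $$\Phi''(0)\Phi(0)\neq\Phi'(0)^2.$$ Suppose that $\Phi^{-1}(\mathbb{D})$ contains arbitrarily long arithmetic progressions of the form $\{ja\}_{j=1}^m$; that is, for every $m\in\mathbb{N}$ there exists $a\in\mathbb{C}\setminus\{0\}$ such that $|\Phi(ja)|<1$ for $j=1,\dots,m$. Then $\Phi(D)$ supports a hypercyclic algebra.
   Context: $\mathbb{D}$ is the open unit disc in $\mathbb{C}$. $H(\mathbb{C})$ is the algebra (under pointwise multiplication) of entire functions on $\mathbb{C}$ with the compact-open topology, and $D:f\mapsto f'$. An entire function $\Phi$ is of exponential type if there are constants $A,B<\infty$ with $|\Phi(z)|\le Ae^{B|z|}$ for all $z$. For such $\Phi(z)=\sum_{n\ge0}a_nz^n$, $\Phi(D):H(\mathbb{C})\to H(\mathbb{C})$ is the continuous linear operator $f\mapsto\sum_{n\ge0}a_nD^nf$. A vector is hypercyclic for an operator $T$ if its orbit under $T$ is dense. A hypercyclic algebra for $T$ is a (nonzero) subalgebra all of whose non-zero elements are hypercyclic vectors for $T$; "$T$ supports a hypercyclic algebra" means that one exists. *)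

theory Defs
  imports "HOL-Complex_Analysis.Complex_Analysis"
begin

definition entire_functions :: "(complex \<Rightarrow> complex) set" where
  "entire_functions = {f. f holomorphic_on UNIV}"

text \<open>The space \<open>H(\<complex>)\<close>: the sets of all entire \<open>f\<close> with \<open>f ` K \<subseteq> U\<close>, for \<open>K\<close> compact and
  \<open>U\<close> open, form a subbase. The choice \<open>K = {}\<close> puts every entire function into the underlying space.\<close>

definition entire_topology :: "(complex \<Rightarrow> complex) topology" where
  "entire_topology = topology_generated_by
     {{f \<in> entire_functions. f ` K \<subseteq> U} | K U. compact K \<and> open U}"

lemma topspace_entire_topology [simp]: "topspace entire_topology = entire_functions"
proof -
  have "entire_functions \<in> {{f \<in> entire_functions. f ` K \<subseteq> U} | K U. compact K \<and> open U}"
    by (intro CollectI exI[of _ "{}"]) auto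
  then show ?thesis
    unfolding entire_topology_def topology_generated_by_topspace by blast
qed

definition exponential_type :: "(complex \<Rightarrow> complex) \<Rightarrow> bool" where
  "exponential_type \<Phi> \<longleftrightarrow> (\<exists>A B :: real. \<forall>z. norm (\<Phi> z) \<le> A * exp (B * norm z))"

text \<open>The operator \<open>\<Phi>(D)\<close>. The series \<open>\<Sum> a\<^sub>n D\<^sup>n f\<close>, with \<open>a\<^sub>n\<close> the Taylor coefficients of \<open>\<Phi>\<close> at \<open>0\<close>,
  is summed pointwise; by
  \<open>diff_op_uniform_limit\<close> and \<open>diff_op_entire\<close> below, for \<open>\<Phi>\<close> of exponential type and \<open>f\<close> entire, its partial sums converge to this pointwise
  sum uniformly on compact sets, so it is also the sum in \<open>H(\<complex>)\<close>.\<close>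

definition diff_op :: "(complex \<Rightarrow> complex) \<Rightarrow> (complex \<Rightarrow> complex) \<Rightarrow> (complex \<Rightarrow> complex)" where
  "diff_op \<Phi> f = (\<lambda>z. \<Sum>n. (deriv ^^ n) \<Phi> 0 / fact n * (deriv ^^ n) f z)"

lemma diff_op_uniform_limit:
  assumes \<Phi>: "\<Phi> \<in> entire_functions" "exponential_type \<Phi>"
    and f: "f \<in> entire_functions" and K: "compact K"
  shows "uniform_limit K
    (\<lambda>N z. \<Sum>n<N. (deriv ^^ n) \<Phi> 0 / fact n * (deriv ^^ n) f z) (diff_op \<Phi> f) sequentially"
proof -
  obtain A B' where AB': "\<And>z. norm (\<Phi> z) \<le> A * exp (B' * norm z)"
    using \<Phi>(2) unfolding exponential_type_def by blast
  have A: "A \<ge> 0" using order_trans[OF norm_ge_zero AB'[of 0]] by simp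
  define B where "B = max 1 B'"
  have B: "B > 0" by (simp add: B_def)
  have AB: "norm (\<Phi> z) \<le> A * exp (B * norm z)" for z
  proof -
    have "A * exp (B' * norm z) \<le> A * exp (B * norm z)"
      using A by (intro mult_left_mono) (auto simp: B_def intro!: mult_right_mono)
    with AB'[of z] show ?thesis by linarith
  qed
  define R where "R = 2 * exp 1 * B"
  have R: "R > 0" using B by (simp add: R_def)
  obtain r where r: "\<And>z. z \<in> K \<Longrightarrow> norm z \<le> r" "r > 0"
    using compact_imp_bounded[OF K] unfolding bounded_pos by auto
  have "compact (f ` cball 0 (r + R))"
    using f unfolding entire_functions_def
    by (intro compact_continuous_image)
       (auto intro: holomorphic_on_imp_continuous_on holomorphic_on_subset)
  then obtain M where M: "M > 0" "\<And>z. norm z \<le> r + R \<Longrightarrow> norm (f z) \<le> M"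
    using compact_imp_bounded[of "f ` cball 0 (r + R)"] unfolding bounded_pos by auto
  have hol: "g holomorphic_on S" "continuous_on S g" if "g \<in> entire_functions" for g S
    using that unfolding entire_functions_def
    by (auto intro: holomorphic_on_imp_continuous_on holomorphic_on_subset)
  have bound: "norm ((deriv ^^ n) \<Phi> 0 / fact n * (deriv ^^ n) f z) \<le> A * M * (1 / 2) ^ n"
    if n: "n > 0" and z: "z \<in> K" for n z
  proof -
    define s where "s = n / B"
    have s: "s > 0" using n B by (simp add: s_def)
    have 1: "norm ((deriv ^^ n) \<Phi> 0) \<le> fact n * (A * exp (B * s)) / s ^ n"
    proof (rule Cauchy_inequality)
      fix x assume "norm (0 - x :: complex) = s"
      then show "norm (\<Phi> x) \<le> A * exp (B * s)" using AB[of x] by simp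
    qed (use s hol \<Phi> in auto)
    have 2: "norm ((deriv ^^ n) f z) \<le> fact n * M / R ^ n"
    proof (rule Cauchy_inequality)
      fix x assume "norm (z - x) = R"
      then have "norm x \<le> r + R"
        using r(1)[OF z] norm_triangle_ineq2[of x z] by (simp add: norm_minus_commute)
      then show "norm (f x) \<le> M" by (rule M(2))
    qed (use R hol f in auto)
    have "norm ((deriv ^^ n) \<Phi> 0 / fact n * (deriv ^^ n) f z)
        = norm ((deriv ^^ n) \<Phi> 0) / fact n * norm ((deriv ^^ n) f z)"
      by (simp add: norm_mult norm_divide)
    also have "\<dots> \<le> (A * exp (B * s) / s ^ n) * (fact n * M / R ^ n)"
      using 1 2 A s by (intro mult_mono) (auto simp: field_simps)
    also have "\<dots> \<le> (A * exp (B * s) / s ^ n) * (real n ^ n * M / R ^ n)"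
    proof -
      have "fact n \<le> real n ^ n" using fact_le_power[of n, where ?'a = real] by simp
      then show ?thesis using A s M(1) R
        by (intro mult_left_mono divide_right_mono mult_right_mono) auto
    qed
    also have "\<dots> = A * M * (1 / 2) ^ n"
    proof -
      have "exp (B * s) = exp 1 ^ n" using B by (simp add: s_def exp_of_nat_mult[symmetric])
      then show ?thesis using n B
        by (simp add: s_def R_def power_mult_distrib power_divide)
    qed
    finally show ?thesis .
  qed
  have "uniform_limit K
    (\<lambda>N z. \<Sum>n<N. (deriv ^^ n) \<Phi> 0 / fact n * (deriv ^^ n) f z)
    (\<lambda>z. \<Sum>n. (deriv ^^ n) \<Phi> 0 / fact n * (deriv ^^ n) f z) sequentially"
  proof (rule Weierstrass_m_test_ev)
    show "\<forall>\<^sub>F n in sequentially. \<forall>z\<in>K.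
        norm ((deriv ^^ n) \<Phi> 0 / fact n * (deriv ^^ n) f z) \<le> A * M * (1 / 2) ^ n"
      using bound by (intro eventually_sequentiallyI[of 1]) auto
  qed (auto intro!: summable_mult summable_geometric)
  then show ?thesis unfolding diff_op_def .
qed

lemma diff_op_entire:
  assumes "\<Phi> \<in> entire_functions" "exponential_type \<Phi>" "f \<in> entire_functions"
  shows "diff_op \<Phi> f \<in> entire_functions"
proof -
  have "diff_op \<Phi> f holomorphic_on UNIV"
  proof (rule holomorphic_uniform_sequence)
    show "(\<lambda>z. \<Sum>n<N. (deriv ^^ n) \<Phi> 0 / fact n * (deriv ^^ n) f z) holomorphic_on UNIV" for N
      using assms(3) unfolding entire_functions_def
      by (auto intro!: holomorphic_intros holomorphic_higher_deriv)
    show "\<exists>d>0. cball x d \<subseteq> UNIV \<and> uniform_limit (cball x d)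
        (\<lambda>N z. \<Sum>n<N. (deriv ^^ n) \<Phi> 0 / fact n * (deriv ^^ n) f z) (diff_op \<Phi> f) sequentially" for x
      using diff_op_uniform_limit[OF assms compact_cball] by (intro exI[of _ 1]) auto
  qed auto
  then show ?thesis by (simp add: entire_functions_def)
qed

definition hypercyclic_vector :: "'a topology \<Rightarrow> ('a \<Rightarrow> 'a) \<Rightarrow> 'a \<Rightarrow> bool" where
  "hypercyclic_vector X T x \<longleftrightarrow>
     x \<in> topspace X \<and> X closure_of (range (\<lambda>n. (T ^^ n) x)) = topspace X"

text \<open>Subalgebras need not contain the unit (constants are never hypercyclic for \<open>\<Phi>(D)\<close>).\<close>

definition subalgebra_entire :: "(complex \<Rightarrow> complex) set \<Rightarrow> bool" where
  "subalgebra_entire \<A> \<longleftrightarrow> \<A> \<subseteq> entire_functions \<and> (\<lambda>z. 0) \<in> \<A> \<and>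
     (\<forall>f\<in>\<A>. \<forall>g\<in>\<A>. (\<lambda>z. f z + g z) \<in> \<A>) \<and>
     (\<forall>c. \<forall>f\<in>\<A>. (\<lambda>z. c * f z) \<in> \<A>) \<and>
     (\<forall>f\<in>\<A>. \<forall>g\<in>\<A>. (\<lambda>z. f z * g z) \<in> \<A>)"

definition hypercyclic_algebra ::
    "((complex \<Rightarrow> complex) \<Rightarrow> (complex \<Rightarrow> complex)) \<Rightarrow> (complex \<Rightarrow> complex) set \<Rightarrow> bool" where
  "hypercyclic_algebra T \<A> \<longleftrightarrow> subalgebra_entire \<A> \<and> \<A> \<noteq> {\<lambda>z. 0} \<and>
     (\<forall>f\<in>\<A> - {\<lambda>z. 0}. hypercyclic_vector entire_topology T f)"

definition supports_hypercyclic_algebra ::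
    "((complex \<Rightarrow> complex) \<Rightarrow> (complex \<Rightarrow> complex)) \<Rightarrow> bool" where
  "supports_hypercyclic_algebra T \<longleftrightarrow> (\<exists>\<A>. hypercyclic_algebra T \<A>)"

end

theory Submission
  imports Defs
begin

text \<open>Write \<open>T = \<Phi>(D)\<close>. Exponentials \<open>exp (c * z)\<close> are eigenvectors of \<open>T\<close> with eigenvalue \<open>\<Phi> c\<close>.
  It suffices to find an entire \<open>f\<close> such that for every \<open>m \<ge> 1\<close> and every entire \<open>h\<close> some iterate
  of \<open>T\<close> maps \<open>f, f\<^sup>2, \<dots>, f ^ (m - 1)\<close> close to \<open>0\<close> and \<open>f ^ m\<close> close to \<open>h\<close>: then for every
  nonzero polynomial \<open>P\<close> with \<open>P(0) = 0\<close> the leading term of \<open>P(f)\<close> can be steered anywhere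
  while the other terms disappear (\<open>polynomial_orbit_dense\<close>), and these \<open>P(f)\<close> form a hypercyclic algebra.
  By the Baire category theorem (\<open>Baire_entire\<close>) such an \<open>f\<close> exists if, for each single \<open>m\<close> and \<open>h\<close>, functions
  with this property are found near every entire \<open>f0\<close> (\<open>powers_near_targets\<close>).

  These are built as exponential sums. Given \<open>m\<close>, choose \<open>a\<close> with \<open>\<bar>\<Phi> (j * a)\<bar> < 1\<close> for \<open>1 \<le> j \<le> m\<close>, and
  approximate \<open>f0\<close> by a sum of exponentials with frequencies close to \<open>a\<close>; iterates of \<open>T\<close> kill
  all powers of this sum up to the \<open>m\<close>-th. Add a perturbation with frequencies close to \<open>0\<close> whose
  \<open>m\<close>-th power is carried to \<open>h\<close>. Mixed products still have frequencies close to some \<open>j * a\<close> with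
  \<open>j \<ge> 1\<close>, so they die too. The products inside the perturbation are controlled by convexity:
  the condition \<open>\<Phi>''(0) * \<Phi>(0) \<noteq> \<Phi>'(0)\<^sup>2\<close> says that \<open>log \<Phi>\<close> has a nonzero second derivative at
  \<open>0\<close>, so on a suitable short segment starting at \<open>0\<close> the function \<open>ln \<bar>\<Phi>\<bar>\<close> is strictly convex,
  zero at \<open>0\<close> and positive elsewhere (\<open>log_strictly_convex_direction\<close>). With the frequencies there, the strict Jensen inequality shows
  that of all products of at most \<open>m\<close> factors only the \<open>m\<close>-th powers of single exponentials survive.\<close>

section \<open>Neighbourhoods and category in the space of entire functions\<close>

text \<open>As \<open>R\<close> and \<open>e > 0\<close> vary, the entire functions \<open>f\<close> with \<open>near R e f g\<close> form a neighbourhood base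
  of \<open>g\<close> in the compact-open topology, so all approximation below is phrased with this predicate.\<close>
definition near :: "real \<Rightarrow> real \<Rightarrow> (complex \<Rightarrow> complex) \<Rightarrow> (complex \<Rightarrow> complex) \<Rightarrow> bool" where
  "near R e f g \<longleftrightarrow> (\<forall>z. norm z \<le> R \<longrightarrow> norm (f z - g z) < e)"

lemma near_mono: "near R e f g \<Longrightarrow> R' \<le> R \<Longrightarrow> e \<le> e' \<Longrightarrow> near R' e' f g"
  unfolding near_def by (meson order_trans less_le_trans)

lemma near_triangle: "near R e f g \<Longrightarrow> near R e' g h \<Longrightarrow> near R (e + e') f h"
  unfolding near_def by (metis (no_types, lifting) norm_diff_triangle_less)

lemma uniform_limit_eventually_near:
  assumes "uniform_limit (cball 0 R) F f sequentially" "e > 0"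
  shows "\<forall>\<^sub>F n in sequentially. near R e (F n) f"
  using uniform_limitD[OF assms] unfolding near_def by eventually_elim (auto simp: dist_norm)

lemma entire_holomorphic: "f \<in> entire_functions \<Longrightarrow> f holomorphic_on S"
  unfolding entire_functions_def by (auto intro: holomorphic_on_subset)

lemma entire_continuous: "f \<in> entire_functions \<Longrightarrow> continuous_on S f"
  by (intro holomorphic_on_imp_continuous_on entire_holomorphic)

lemma entire_bounded_on_disc:
  assumes "f \<in> entire_functions"
  obtains M where "M > 0" "\<And>z. norm z \<le> R \<Longrightarrow> norm (f z) \<le> M"
proof -
  have "compact (f ` cball 0 R)"
    by (intro compact_continuous_image entire_continuous assms compact_cball)
  then obtain M where "M > 0" "\<forall>x\<in>f ` cball 0 R. norm x \<le> M"
    using compact_imp_bounded bounded_pos by blast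
  then show ?thesis using that by simp
qed

text \<open>A subbasic set \<open>{f. f ` K \<subseteq> U}\<close> around \<open>h\<close> leaves room for a uniform error, because the
  compact set \<open>h ` K\<close> has positive distance to the complement of \<open>U\<close>.\<close>
lemma openin_entire_contains_near:
  assumes "openin entire_topology U" "h \<in> U"
  shows "\<exists>R e. e > 0 \<and> (\<forall>g \<in> entire_functions. near R e g h \<longrightarrow> g \<in> U)"
  using assms unfolding entire_topology_def openin_topology_generated_by_iff
proof (induction U rule: generate_topology_on.induct)
  case Empty
  then show ?case by simp
next
  case (Int a b)
  then obtain R e where a: "e > 0" "\<forall>g \<in> entire_functions. near R e g h \<longrightarrow> g \<in> a" by blast
  from Int obtain R' e' where b: "e' > 0" "\<forall>g \<in> entire_functions. near R' e' g h \<longrightarrow> g \<in> b" by blast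
  have "g \<in> a \<inter> b" if g: "g \<in> entire_functions" "near (max R R') (min e e') g h" for g
    using a(2) b(2) g(1) near_mono[OF g(2), of R e] near_mono[OF g(2), of R' e'] by auto
  moreover have "min e e' > 0" using a(1) b(1) by simp
  ultimately show ?case
    by (intro exI[of _ "max R R'"] exI[of _ "min e e'"] conjI ballI impI)
next
  case (UN K)
  then obtain k where k: "k \<in> K" "h \<in> k" by blast
  from UN.IH[OF this] obtain R e where
    "e > 0" "\<forall>g \<in> entire_functions. near R e g h \<longrightarrow> g \<in> k" by blast
  then show ?case using k(1) by (intro exI[of _ R] exI[of _ e]) auto
next
  case (Basis s)
  then obtain K U where s: "s = {f \<in> entire_functions. f ` K \<subseteq> U}" "compact K" "open U" by blast
  with Basis have h: "h \<in> entire_functions" "h ` K \<subseteq> U" by auto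
  have "compact (h ` K)" by (intro compact_continuous_image entire_continuous h s)
  then obtain e where e: "e > 0" "(\<Union>x\<in>h ` K. ball x e) \<subseteq> U"
    using compact_subset_open_imp_ball_epsilon_subset[OF _ s(3) h(2)] by metis
  obtain R where R: "\<And>z. z \<in> K \<Longrightarrow> norm z \<le> R"
    using compact_imp_bounded[OF s(2)] unfolding bounded_iff by blast
  have "g \<in> s" if g: "g \<in> entire_functions" "near R e g h" for g
  proof -
    have "g z \<in> ball (h z) e" if "z \<in> K" for z
      using g(2) R[OF that] unfolding near_def by (auto simp: dist_norm norm_minus_commute)
    with e(2) have "g ` K \<subseteq> U" by fast
    with g s show ?thesis by auto
  qed
  with e(1) show ?case by blast
qed

lemma hypercyclic_vectorI:
  assumes f: "f \<in> entire_functions" and T: "\<And>g. g \<in> entire_functions \<Longrightarrow> T g \<in> entire_functions"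
    and dense: "\<And>h R e. h \<in> entire_functions \<Longrightarrow> e > 0 \<Longrightarrow> \<exists>n. near R e ((T ^^ n) f) h"
  shows "hypercyclic_vector entire_topology T f"
proof -
  have orbit: "(T ^^ n) f \<in> entire_functions" for n by (induction n) (auto simp: f T)
  have "h \<in> entire_topology closure_of range (\<lambda>n. (T ^^ n) f)" if h: "h \<in> entire_functions" for h
    unfolding in_closure_of
  proof (intro conjI allI impI)
    fix U assume "h \<in> U \<and> openin entire_topology U"
    then obtain R e where "e > 0" "\<forall>g \<in> entire_functions. near R e g h \<longrightarrow> g \<in> U"
      using openin_entire_contains_near by blast
    with dense[OF h] orbit show "\<exists>y. y \<in> range (\<lambda>n. (T ^^ n) f) \<and> y \<in> U" by blast
  qed (simp add: h)
  moreover have "entire_topology closure_of range (\<lambda>n. (T ^^ n) f) \<subseteq> entire_functions"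
    using closure_of_subset_topspace[of entire_topology] by simp
  ultimately show ?thesis unfolding hypercyclic_vector_def using f by auto
qed

text \<open>The Baire category theorem in the Frechet space \<open>H(\<complex>)\<close>, for sets with dense interior: a nested
  sequence of neighbourhoods with growing discs and shrinking radii has a common point, because
  locally uniform limits of holomorphic functions are holomorphic.\<close>
lemma Baire_entire:
  fixes G :: "nat \<Rightarrow> (complex \<Rightarrow> complex) set"
  assumes dense_interior: "\<And>n f R e. f \<in> entire_functions \<Longrightarrow> e > 0 \<Longrightarrow>
     \<exists>g \<in> entire_functions. near R e g f \<and>
       (\<exists>R' d. d > 0 \<and> (\<forall>h \<in> entire_functions. near R' d h g \<longrightarrow> h \<in> G n))"
  shows "\<exists>f \<in> entire_functions. \<forall>n. f \<in> G n"
proof -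
  \<comment> \<open>The neighbourhood of radius \<open>2 * d\<close> lies in \<open>G n\<close>, although later approximants stay within \<open>d\<close>:
     the limit only inherits the non-strict bound \<open>d\<close>.\<close>
  define inv :: "nat \<Rightarrow> (complex \<Rightarrow> complex) \<times> real \<times> real \<Rightarrow> bool" where
    "inv = (\<lambda>n (f, R, d). f \<in> entire_functions \<and> R \<ge> real n \<and> 0 < d \<and> d \<le> (1/2) ^ n \<and>
       (\<forall>h \<in> entire_functions. near R (2 * d) h f \<longrightarrow> h \<in> G n))"
  define succ :: "(complex \<Rightarrow> complex) \<times> real \<times> real \<Rightarrow> (complex \<Rightarrow> complex) \<times> real \<times> real \<Rightarrow> bool" where
    "succ = (\<lambda>(f, R, d) (f', R', d'). R \<le> R' \<and> d' \<le> d / 2 \<and> near R (d / 2) f' f)"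
  have refine: "\<exists>f' R' d'. inv n (f', R', d') \<and> R \<le> R' \<and> d' \<le> d / 2 \<and> near R (d / 2) f' f"
    if f: "f \<in> entire_functions" "d > 0" for f R d n
  proof -
    obtain g R' e where g: "g \<in> entire_functions" "near R (d / 2) g f" "e > 0"
      "\<forall>h \<in> entire_functions. near R' e h g \<longrightarrow> h \<in> G n"
      using dense_interior[OF f(1), of "d / 2" R n] f(2) by auto
    let ?R = "max (max R R') (real n)" and ?d = "min (e / 2) (min (d / 2) ((1/2) ^ n))"
    have "inv n (g, ?R, ?d)"
      unfolding inv_def using g f by (auto elim!: near_mono intro!: bspec[OF g(4), THEN mp])
    with g(2) show ?thesis by (intro exI[of _ g] exI[of _ ?R] exI[of _ ?d]) auto
  qed
  have "\<exists>s. \<forall>n. inv n (s n) \<and> succ (s n) (s (Suc n))"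
  proof (rule dependent_nat_choice)
    have "(\<lambda>z. 0) \<in> entire_functions" by (simp add: entire_functions_def)
    from refine[OF this, of 1 0 0] show "\<exists>x. inv 0 x" by auto
    show "\<exists>y. inv (Suc n) y \<and> succ x y" if "inv n x" for x n
      using that refine[of "fst x" "snd (snd x)" "Suc n" "fst (snd x)"]
      unfolding inv_def succ_def by (auto simp: case_prod_beta)
  qed
  then obtain s where s: "\<And>n. inv n (s n)" "\<And>n. succ (s n) (s (Suc n))" by blast
  define f where "f n = fst (s n)" for n
  define R where "R n = fst (snd (s n))" for n
  define d where "d n = snd (snd (s n))" for n
  have ent: "f n \<in> entire_functions" and Rn: "R n \<ge> real n" and d0: "0 < d n"
    and dle: "d n \<le> (1/2) ^ n"
    and G: "\<And>h. h \<in> entire_functions \<Longrightarrow> near (R n) (2 * d n) h (f n) \<Longrightarrow> h \<in> G n" for n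
    using s(1)[of n] unfolding inv_def f_def R_def d_def by (auto simp: case_prod_beta)
  have Rm: "R n \<le> R (Suc n)" and dm: "d (Suc n) \<le> d n / 2"
    and st: "near (R n) (d n / 2) (f (Suc n)) (f n)" for n
    using s(2)[of n] unfolding succ_def f_def R_def d_def by (auto simp: case_prod_beta)
  have R_mono: "R n \<le> R m" if "n \<le> m" for n m
    using that by (rule lift_Suc_mono_le[of R, rotated]) (rule Rm)
  \<comment> \<open>Each step moves by less than \<open>d k / 2\<close>, which is at most the loss of radius \<open>d k - d (Suc k)\<close>;
     so the bounds telescope.\<close>
  have step: "norm (f k z - f n z) \<le> d n - d k" if "n \<le> k" "norm z \<le> R n" for n k z
    using that(1)
  proof (induction k rule: dec_induct)
    case (step k)
    have "norm (f (Suc k) z - f k z) < d k / 2"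
      using st[of k] R_mono[of n k] step that unfolding near_def by auto
    moreover have "norm (f (Suc k) z - f n z) \<le> norm (f (Suc k) z - f k z) + norm (f k z - f n z)"
      by (rule norm_diff_triangle_le) auto
    ultimately show ?case using step.IH dm[of k] by linarith
  qed simp
  have step': "norm (f k z - f n z) \<le> d n" if "n \<le> k" "norm z \<le> R n" for n k z
    using step[OF that] d0[of k] by simp
  have d_lim: "d \<longlonglongrightarrow> 0"
    by (rule tendsto_sandwich[OF _ _ tendsto_const LIMSEQ_power_zero[of "1/2::real"]])
       (use d0 dle in \<open>auto intro: always_eventually less_imp_le\<close>)
  have "Cauchy (\<lambda>n. f n z)" for z
  proof (rule metric_CauchyI)
    fix e :: real assume "e > 0"
    with d_lim have "\<forall>\<^sub>F n in sequentially. d n < e / 2" by (intro order_tendstoD) auto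
    moreover have "\<forall>\<^sub>F n in sequentially. norm z \<le> real n"
      using eventually_ge_at_top[of "nat \<lceil>norm z\<rceil>"] by eventually_elim linarith
    ultimately have "\<forall>\<^sub>F n in sequentially. d n < e / 2 \<and> norm z \<le> real n" by eventually_elim auto
    then obtain N where N: "d N < e / 2" "norm z \<le> real N"
      using eventually_happens'[OF sequentially_bot] by blast
    have "dist (f k z) (f N z) < e / 2" if "k \<ge> N" for k
      using step'[OF that, of z] N Rn[of N] by (simp add: dist_norm)
    then show "\<exists>M. \<forall>m\<ge>M. \<forall>n\<ge>M. dist (f m z) (f n z) < e" by (meson dist_triangle_half_l)
  qed
  then have "\<exists>l. (\<lambda>n. f n z) \<longlonglongrightarrow> l" for z using Cauchy_convergent convergent_def by blast
  then obtain g where g: "\<And>z. (\<lambda>n. f n z) \<longlonglongrightarrow> g z" by metis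
  have lim: "norm (g z - f n z) \<le> d n" if "norm z \<le> R n" for n z
  proof (rule tendsto_upperbound)
    show "(\<lambda>k. norm (f k z - f n z)) \<longlonglongrightarrow> norm (g z - f n z)" by (intro tendsto_intros g)
    show "\<forall>\<^sub>F k in sequentially. norm (f k z - f n z) \<le> d n"
      using eventually_ge_at_top[of n] by eventually_elim (use step' that in auto)
  qed simp
  have "g holomorphic_on UNIV"
  proof (rule holomorphic_uniform_sequence)
    show "f n holomorphic_on UNIV" for n by (rule entire_holomorphic[OF ent])
    show "\<exists>r>0. cball x r \<subseteq> UNIV \<and> uniform_limit (cball x r) f g sequentially" for x
    proof (intro exI[of _ 1] conjI uniform_limitI)
      fix e :: real assume "e > 0"
      with d_lim have "\<forall>\<^sub>F n in sequentially. d n < e" by (intro order_tendstoD) auto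
      moreover have "\<forall>\<^sub>F n in sequentially. norm x + 1 \<le> real n"
        using eventually_ge_at_top[of "nat \<lceil>norm x + 1\<rceil>"] by eventually_elim linarith
      ultimately show "\<forall>\<^sub>F n in sequentially. \<forall>z\<in>cball x 1. dist (f n z) (g z) < e"
      proof eventually_elim
        case (elim n)
        show ?case
        proof
          fix z assume "z \<in> cball x 1"
          then have "norm z \<le> norm x + 1"
            by (metis dist_norm mem_cball norm_minus_commute add_le_cancel_left norm_triangle_sub order_trans)
          then have "norm (g z - f n z) \<le> d n" using lim[of z n] elim Rn[of n] by linarith
          then show "dist (f n z) (g z) < e" using elim by (simp add: dist_norm norm_minus_commute)
        qed
      qed
    qed auto
  qed simp
  then have "g \<in> entire_functions" by (simp add: entire_functions_def)
  moreover have "near (R n) (2 * d n) g (f n)" for n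
    using lim d0[of n] unfolding near_def by (smt (verit))
  ultimately show ?thesis using G by blast
qed

section \<open>Convolution operators\<close>

lemma entire_add: "f \<in> entire_functions \<Longrightarrow> g \<in> entire_functions \<Longrightarrow> (\<lambda>z. f z + g z) \<in> entire_functions"
  and entire_diff: "f \<in> entire_functions \<Longrightarrow> g \<in> entire_functions \<Longrightarrow> (\<lambda>z. f z - g z) \<in> entire_functions"
  and entire_mult: "f \<in> entire_functions \<Longrightarrow> g \<in> entire_functions \<Longrightarrow> (\<lambda>z. f z * g z) \<in> entire_functions"
  and entire_power: "f \<in> entire_functions \<Longrightarrow> (\<lambda>z. f z ^ n) \<in> entire_functions"
  and entire_const: "(\<lambda>z. c) \<in> entire_functions"
  and entire_exp: "(\<lambda>z. exp (c * z)) \<in> entire_functions"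
  unfolding entire_functions_def by (auto intro!: holomorphic_intros)

lemma entire_sum: "(\<And>i. i \<in> I \<Longrightarrow> f i \<in> entire_functions) \<Longrightarrow> (\<lambda>z. \<Sum>i\<in>I. f i z) \<in> entire_functions"
  unfolding entire_functions_def by (auto intro!: holomorphic_intros)

text \<open>Exponential type amounts to geometric growth of the derivatives at \<open>0\<close>. Hence the
  coefficients of \<open>\<Phi>(D)\<close> beat the factorials in Cauchy's estimate for the derivatives of \<open>f\<close>.\<close>
lemma exponential_type_Taylor_bound:
  assumes \<Phi>: "\<Phi> \<in> entire_functions" "exponential_type \<Phi>"
  shows "\<exists>A B. A \<ge> 0 \<and> B > 0 \<and> (\<forall>n. norm ((deriv ^^ n) \<Phi> 0) \<le> A * B ^ n)"
proof -
  obtain A B' where AB': "\<And>z. norm (\<Phi> z) \<le> A * exp (B' * norm z)"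
    using \<Phi>(2) unfolding exponential_type_def by blast
  have A: "A \<ge> 0" using order_trans[OF norm_ge_zero AB'[of 0]] by simp
  define B where "B = max 1 B'"
  have B: "B > 0" by (simp add: B_def)
  have AB: "norm (\<Phi> z) \<le> A * exp (B * norm z)" for z
  proof -
    have "A * exp (B' * norm z) \<le> A * exp (B * norm z)"
      using A by (intro mult_left_mono) (auto simp: B_def intro!: mult_right_mono)
    with AB'[of z] show ?thesis by linarith
  qed
  have "norm ((deriv ^^ n) \<Phi> 0) \<le> A * (exp 1 * B) ^ n" for n
  proof (cases "n = 0")
    case True
    then show ?thesis using AB[of 0] by simp
  next
    case False
    \<comment> \<open>The radius \<open>n / B\<close> minimises \<open>exp (B * s) / s ^ n\<close>.\<close>
    define s where "s = real n / B"
    have s: "s > 0" using False B by (simp add: s_def)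
    have "norm ((deriv ^^ n) \<Phi> 0) \<le> fact n * (A * exp (B * s)) / s ^ n"
    proof (rule Cauchy_inequality)
      fix x assume "norm (0 - x :: complex) = s"
      then show "norm (\<Phi> x) \<le> A * exp (B * s)" using AB[of x] by simp
    qed (use s entire_continuous entire_holomorphic \<Phi> in auto)
    also have "\<dots> \<le> real n ^ n * (A * exp (B * s)) / s ^ n"
      using fact_le_power[of n, where ?'a = real] A s
      by (intro divide_right_mono mult_right_mono) auto
    also have "exp (B * s) = exp 1 ^ n" using B by (simp add: s_def exp_of_nat_mult[symmetric])
    also have "real n ^ n * (A * exp 1 ^ n) / s ^ n = A * (exp 1 * B) ^ n"
      using False B by (simp add: s_def power_mult_distrib power_divide)
    finally show ?thesis .
  qed
  then show ?thesis using A B by (intro exI[of _ A] exI[of _ "exp 1 * B"]) auto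
qed

locale convolution_operator =
  fixes \<Phi> :: "complex \<Rightarrow> complex"
  assumes \<Phi>_entire: "\<Phi> \<in> entire_functions" and \<Phi>_type: "exponential_type \<Phi>"
begin

abbreviation T :: "(complex \<Rightarrow> complex) \<Rightarrow> complex \<Rightarrow> complex" where "T \<equiv> diff_op \<Phi>"

lemma T_entire: "f \<in> entire_functions \<Longrightarrow> T f \<in> entire_functions"
  by (rule diff_op_entire[OF \<Phi>_entire \<Phi>_type])

lemma T_sums:
  assumes "f \<in> entire_functions"
  shows "(\<lambda>n. (deriv ^^ n) \<Phi> 0 / fact n * (deriv ^^ n) f z) sums T f z"
  using diff_op_uniform_limit[OF \<Phi>_entire \<Phi>_type assms compact_sing, of z] by (simp add: sums_def)

lemma T_add:
  assumes "f \<in> entire_functions" "g \<in> entire_functions"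
  shows "T (\<lambda>z. f z + g z) = (\<lambda>z. T f z + T g z)"
proof
  fix z
  have "(deriv ^^ n) (\<lambda>z. f z + g z) z = (deriv ^^ n) f z + (deriv ^^ n) g z" for n
    by (rule higher_deriv_add[OF entire_holomorphic entire_holomorphic open_UNIV])
      (use assms in auto)
  then have "(\<lambda>n. (deriv ^^ n) \<Phi> 0 / fact n * (deriv ^^ n) (\<lambda>z. f z + g z) z) sums (T f z + T g z)"
    using sums_add[OF T_sums[OF assms(1)] T_sums[OF assms(2)]] by (simp add: algebra_simps add_divide_distrib)
  then show "T (\<lambda>z. f z + g z) z = T f z + T g z"
    using T_sums[OF entire_add[OF assms]] sums_unique2 by blast
qed

lemma T_cmult:
  assumes "f \<in> entire_functions"
  shows "T (\<lambda>z. c * f z) = (\<lambda>z. c * T f z)"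
proof
  fix z
  have "(deriv ^^ n) (\<lambda>z. c * f z) z = c * (deriv ^^ n) f z" for n
    by (rule higher_deriv_cmult[OF entire_holomorphic _ open_UNIV]) (use assms in auto)
  then have "(\<lambda>n. (deriv ^^ n) \<Phi> 0 / fact n * (deriv ^^ n) (\<lambda>z. c * f z) z) sums (c * T f z)"
    using sums_mult[OF T_sums[OF assms], of c] by (simp add: mult_ac)
  then show "T (\<lambda>z. c * f z) z = c * T f z"
    using T_sums[OF entire_mult[OF entire_const assms]] sums_unique2 by blast
qed

lemma T_exp: "T (\<lambda>z. exp (c * z)) = (\<lambda>z. \<Phi> c * exp (c * z))"
proof
  fix z
  have d: "(deriv ^^ n) (\<lambda>z. exp (c * z)) = (\<lambda>z. c ^ n * exp (c * z))" for n
  proof (induction n)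
    case (Suc n)
    have "((\<lambda>z. c ^ n * exp (c * z)) has_field_derivative c ^ Suc n * exp (c * z)) (at z)" for z
      by (auto intro!: derivative_eq_intros)
    then show ?case by (auto simp: Suc intro!: DERIV_imp_deriv)
  qed simp
  have "(\<lambda>n. (deriv ^^ n) \<Phi> 0 / fact n * (c - 0) ^ n) sums \<Phi> c"
    by (rule holomorphic_power_series[where r = "norm c + 1"]) (auto intro: entire_holomorphic \<Phi>_entire)
  from sums_mult2[OF this, of "exp (c * z)"]
  have "(\<lambda>n. (deriv ^^ n) \<Phi> 0 / fact n * (deriv ^^ n) (\<lambda>z. exp (c * z)) z) sums (\<Phi> c * exp (c * z))"
    unfolding d by (simp add: mult_ac)
  then show "T (\<lambda>z. exp (c * z)) z = \<Phi> c * exp (c * z)"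
    using T_sums[OF entire_exp] sums_unique2 by blast
qed

text \<open>Continuity of \<open>\<Phi>(D)\<close>. If the derivatives of \<open>\<Phi>\<close> at \<open>0\<close> grow like \<open>B ^ n\<close>, Cauchy's
  estimate for \<open>f\<close> on circles of radius \<open>2 * B\<close> bounds the \<open>n\<close>-th term of the series by a multiple
  of \<open>(1/2) ^ n\<close>. The enlargement \<open>S\<close> of the disc does not depend on \<open>R\<close>, so the bound can be iterated.\<close>
lemma T_bound: "\<exists>C S. C \<ge> 0 \<and> S \<ge> 0 \<and> (\<forall>f \<in> entire_functions. \<forall>R M z.
    (\<forall>w. norm w \<le> R + S \<longrightarrow> norm (f w) \<le> M) \<longrightarrow> norm z \<le> R \<longrightarrow> norm (T f z) \<le> C * M)"
proof -
  obtain A B where A: "A \<ge> 0" and B: "B > 0"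
    and AB: "\<And>n. norm ((deriv ^^ n) \<Phi> 0) \<le> A * B ^ n"
    using exponential_type_Taylor_bound[OF \<Phi>_entire \<Phi>_type] by blast
  have "norm (T f z) \<le> (2 * A) * M"
    if f: "f \<in> entire_functions" and M: "\<And>w. norm w \<le> R + 2 * B \<Longrightarrow> norm (f w) \<le> M"
      and z: "norm z \<le> R" for f R M z
  proof -
    have M0: "M \<ge> 0" using M[of z] z B by (smt (verit) norm_ge_zero)
    have bound: "norm ((deriv ^^ n) \<Phi> 0 / fact n * (deriv ^^ n) f z) \<le> A * M * (1/2) ^ n" for n
    proof -
      have "norm ((deriv ^^ n) f z) \<le> fact n * M / (2 * B) ^ n"
      proof (rule Cauchy_inequality)
        fix x assume "norm (z - x) = 2 * B"
        then show "norm (f x) \<le> M"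
          using z norm_triangle_ineq2[of x z] by (intro M) (simp add: norm_minus_commute)
      qed (use B f entire_continuous entire_holomorphic in auto)
      then have "norm ((deriv ^^ n) \<Phi> 0) / fact n * norm ((deriv ^^ n) f z)
          \<le> (A * B ^ n) / fact n * (fact n * M / (2 * B) ^ n)"
        using AB[of n] A B by (intro mult_mono divide_right_mono) auto
      also have "\<dots> = A * M * (1/2) ^ n" using B by (simp add: power_mult_distrib power_divide)
      finally show ?thesis by (simp add: norm_mult norm_divide)
    qed
    have "norm (T f z) \<le> (\<Sum>n. A * M * (1/2) ^ n)"
      unfolding sums_unique[OF T_sums[OF f]]
      by (intro norm_suminf_le) (use bound in auto)
    also have "\<dots> = (2 * A) * M" by (subst suminf_mult) (auto simp: suminf_geometric summable_geometric)
    finally show ?thesis .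
  qed
  then show ?thesis using A B by (intro exI[of _ "2 * A"] exI[of _ "2 * B"]) auto
qed

lemma Tn_entire: "f \<in> entire_functions \<Longrightarrow> (T ^^ n) f \<in> entire_functions"
  by (induction n) (auto intro: T_entire)

lemma Tn_add:
  assumes "f \<in> entire_functions" "g \<in> entire_functions"
  shows "(T ^^ n) (\<lambda>z. f z + g z) = (\<lambda>z. (T ^^ n) f z + (T ^^ n) g z)"
  by (induction n) (auto simp: T_add Tn_entire assms)

lemma Tn_cmult:
  assumes "f \<in> entire_functions"
  shows "(T ^^ n) (\<lambda>z. c * f z) = (\<lambda>z. c * (T ^^ n) f z)"
  by (induction n) (auto simp: T_cmult Tn_entire assms)

lemma Tn_sum:
  assumes "\<And>i. i \<in> I \<Longrightarrow> f i \<in> entire_functions"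
  shows "(T ^^ n) (\<lambda>z. \<Sum>i\<in>I. c i * f i z) = (\<lambda>z. \<Sum>i\<in>I. c i * (T ^^ n) (f i) z)"
proof -
  have zero: "(T ^^ n) (\<lambda>z. 0) = (\<lambda>z. 0)" using Tn_cmult[OF entire_const, of n 0 0] by simp
  show ?thesis using assms
    by (induction I rule: infinite_finite_induct)
      (auto simp: zero Tn_add Tn_cmult entire_sum entire_mult entire_const)
qed

lemma Tn_exp: "(T ^^ n) (\<lambda>z. exp (c * z)) = (\<lambda>z. \<Phi> c ^ n * exp (c * z))"
  by (induction n) (simp_all add: T_exp T_cmult entire_exp mult.assoc mult.left_commute)

lemma Tn_bound: "\<exists>C S. C \<ge> 0 \<and> S \<ge> 0 \<and> (\<forall>f \<in> entire_functions. \<forall>R M z.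
    (\<forall>w. norm w \<le> R + S \<longrightarrow> norm (f w) \<le> M) \<longrightarrow> norm z \<le> R \<longrightarrow> norm ((T ^^ n) f z) \<le> C * M)"
proof (induction n)
  case 0
  show ?case by (rule exI[of _ 1], rule exI[of _ 0]) auto
next
  case (Suc n)
  obtain C S where CS: "C \<ge> 0" "S \<ge> 0" "\<And>f R M z. f \<in> entire_functions \<Longrightarrow>
    (\<And>w. norm w \<le> R + S \<Longrightarrow> norm (f w) \<le> M) \<Longrightarrow> norm z \<le> R \<Longrightarrow> norm ((T ^^ n) f z) \<le> C * M"
    using Suc by metis
  obtain C' S' where CS': "C' \<ge> 0" "S' \<ge> 0" "\<And>f R M z. f \<in> entire_functions \<Longrightarrow>
    (\<And>w. norm w \<le> R + S' \<Longrightarrow> norm (f w) \<le> M) \<Longrightarrow> norm z \<le> R \<Longrightarrow> norm (T f z) \<le> C' * M"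
    using T_bound by metis
  have "norm (T ((T ^^ n) f) z) \<le> C' * (C * M)"
    if f: "f \<in> entire_functions" "\<And>w. norm w \<le> R + (S' + S) \<Longrightarrow> norm (f w) \<le> M" "norm z \<le> R" for f R M z
  proof (rule CS'(3)[OF Tn_entire[OF f(1)] _ f(3)])
    show "norm ((T ^^ n) f w) \<le> C * M" if "norm w \<le> R + S'" for w
      by (rule CS(3)[OF f(1) _ that]) (use f(2) in \<open>auto simp: add_ac\<close>)
  qed
  then show ?case using CS CS'
    by (intro exI[of _ "C' * C"] exI[of _ "S' + S"]) (auto simp: mult_ac)
qed

text \<open>This makes the conditions imposed on a generator of the algebra open, as the category
  argument requires.\<close>
lemma Tn_power_continuous:
  assumes f: "f \<in> entire_functions" and e: "e > 0"
  shows "\<exists>R' d. d > 0 \<and> (\<forall>g \<in> entire_functions. near R' d g f \<longrightarrow>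
    near R e ((T ^^ n) (\<lambda>z. g z ^ j)) ((T ^^ n) (\<lambda>z. f z ^ j)))"
proof -
  obtain C S where CS: "C \<ge> 0" "S \<ge> 0" "\<And>f R M z. f \<in> entire_functions \<Longrightarrow>
    (\<And>w. norm w \<le> R + S \<Longrightarrow> norm (f w) \<le> M) \<Longrightarrow> norm z \<le> R \<Longrightarrow> norm ((T ^^ n) f z) \<le> C * M"
    using Tn_bound by metis
  obtain M where M: "M > 0" "\<And>z. norm z \<le> R + S \<Longrightarrow> norm (f z) \<le> M"
    using entire_bounded_on_disc[OF f] by blast
  define e' where "e' = e / (C + 1)"
  have e': "e' > 0" using e CS(1) by (simp add: e'_def)
  have "uniformly_continuous_on (cball 0 (M + 1)) (\<lambda>x :: complex. x ^ j)"
    by (intro compact_uniformly_continuous continuous_intros compact_cball)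
  then obtain d where d: "d > 0"
    "\<And>x y :: complex. norm x \<le> M + 1 \<Longrightarrow> norm y \<le> M + 1 \<Longrightarrow> norm (y - x) < d \<Longrightarrow> norm (y ^ j - x ^ j) < e'"
    unfolding uniformly_continuous_on_def dist_norm using e' by (metis mem_cball_0)
  have "near R e ((T ^^ n) (\<lambda>z. g z ^ j)) ((T ^^ n) (\<lambda>z. f z ^ j))"
    if g: "g \<in> entire_functions" "near (R + S) (min d 1) g f" for g
    unfolding near_def
  proof (intro allI impI)
    fix z :: complex assume z: "norm z \<le> R"
    have "norm (g w ^ j - f w ^ j) \<le> e'" if w: "norm w \<le> R + S" for w
    proof -
      have "norm (g w - f w) < min d 1" using g(2) w unfolding near_def by blast
      moreover from this have "norm (g w) \<le> M + 1"
        using M(2)[OF w] norm_triangle_ineq2[of "g w" "f w"] by linarith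
      ultimately show ?thesis using d(2)[of "f w" "g w"] M(2)[OF w] by simp
    qed
    then have "norm ((T ^^ n) (\<lambda>z. g z ^ j - f z ^ j) z) \<le> C * e'"
      using z by (intro CS(3) entire_diff entire_power f g) auto
    moreover have "(T ^^ n) (\<lambda>z. g z ^ j - f z ^ j) z = (T ^^ n) (\<lambda>z. g z ^ j) z - (T ^^ n) (\<lambda>z. f z ^ j) z"
      using Tn_add[OF entire_power[OF g(1)] entire_mult[OF entire_const entire_power[OF f]], of n j "-1" j]
        Tn_cmult[OF entire_power[OF f], of n "-1" j] by simp
    moreover have "C * e' < e" using e CS(1) by (simp add: e'_def field_simps)
    ultimately show "norm ((T ^^ n) (\<lambda>z. g z ^ j) z - (T ^^ n) (\<lambda>z. f z ^ j) z) < e" by simp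
  qed
  then show ?thesis using d(1) by (intro exI[of _ "R + S"] exI[of _ "min d 1"]) auto
qed

end

section \<open>Convexity on a ray, and density of exponential sums\<close>

text \<open>Near \<open>0\<close> write \<open>\<Phi> = exp L\<close>. The hypothesis on the second derivative says \<open>L''(0) \<noteq> 0\<close>, and
  along the ray \<open>t * w\<close> the function \<open>g t = Re (L (t * w)) = ln \<bar>\<Phi> (t * w)\<bar>\<close> has second derivative
  \<open>Re (w\<^sup>2 * L'')\<close>. If \<open>w\<close> is a square root of \<open>cnj (L''(0))\<close>, this is positive at \<open>0\<close>. Strict
  convexity is recorded as the strict tangent inequality, the form in which Jensen's inequality uses it.\<close>
lemma log_strictly_convex_direction:
  assumes \<Phi>: "\<Phi> \<in> entire_functions" and norm1: "norm (\<Phi> 0) = 1"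
    and curv: "deriv (deriv \<Phi>) 0 * \<Phi> 0 \<noteq> (deriv \<Phi> 0)\<^sup>2"
  shows "\<exists>w \<epsilon> g g'. w \<noteq> 0 \<and> \<epsilon> > 0 \<and> g 0 = 0 \<and> (\<forall>t\<in>{0<..\<epsilon>}. g t > 0) \<and>
    (\<forall>t\<in>{0..\<epsilon>}. norm (\<Phi> (of_real t * w)) = exp (g t)) \<and>
    (\<forall>x\<in>{0..\<epsilon>}. \<forall>y\<in>{0..\<epsilon>}. x \<noteq> y \<longrightarrow> g y > g x + g' x * (y - x :: real))"
proof -
  have "isCont \<Phi> 0" using entire_continuous[OF \<Phi>, of UNIV] by (simp add: continuous_on_eq_continuous_at)
  moreover have "\<Phi> 0 \<noteq> 0" using norm1 by auto
  ultimately obtain r where r: "r > 0" "\<And>z. z \<in> ball 0 r \<Longrightarrow> \<Phi> z \<noteq> 0"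
    using continuous_at_avoid[of 0 \<Phi> 0] by (metis mem_ball)
  obtain L where L: "L holomorphic_on ball 0 r" "\<And>z. z \<in> ball 0 r \<Longrightarrow> exp (L z) = \<Phi> z"
    using holomorphic_logarithm_exists[of "ball 0 r" \<Phi> 0] r entire_holomorphic[OF \<Phi>] by auto
  have L1: "(L has_field_derivative deriv L z) (at z)" if "z \<in> ball 0 r" for z
    by (rule holomorphic_derivI[OF L(1) open_ball that])
  have hL1: "deriv L holomorphic_on ball 0 r" by (rule holomorphic_deriv[OF L(1) open_ball])
  have L2: "(deriv L has_field_derivative deriv (deriv L) z) (at z)" if "z \<in> ball 0 r" for z
    by (rule holomorphic_derivI[OF hL1 open_ball that])
  have hL2: "deriv (deriv L) holomorphic_on ball 0 r" by (rule holomorphic_deriv[OF hL1 open_ball])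
  have d\<Phi>: "deriv \<Phi> z = \<Phi> z * deriv L z" if "z \<in> ball 0 r" for z
  proof -
    have "((\<lambda>z. exp (L z)) has_field_derivative exp (L z) * deriv L z) (at z)"
      using L1[OF that] by (auto intro!: derivative_eq_intros)
    then have "(\<Phi> has_field_derivative exp (L z) * deriv L z) (at z)"
      by (rule has_field_derivative_transform_within_open[OF _ open_ball that]) (use L(2) in auto)
    then show ?thesis using L(2)[OF that] DERIV_imp_deriv by simp
  qed
  have z0: "(0 :: complex) \<in> ball 0 r" using r(1) by simp
  have "((\<lambda>z. \<Phi> z * deriv L z) has_field_derivative deriv \<Phi> 0 * deriv L 0 + \<Phi> 0 * deriv (deriv L) 0) (at 0)"
    using L2[OF z0] holomorphic_derivI[OF entire_holomorphic[OF \<Phi>] open_UNIV, of 0 UNIV]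
    by (auto intro!: derivative_eq_intros simp: mult_ac)
  then have "(deriv \<Phi> has_field_derivative deriv \<Phi> 0 * deriv L 0 + \<Phi> 0 * deriv (deriv L) 0) (at 0)"
    by (rule has_field_derivative_transform_within_open[OF _ open_ball z0]) (use d\<Phi> in auto)
  from DERIV_imp_deriv[OF this] curv have \<beta>: "deriv (deriv L) 0 \<noteq> 0"
    by (auto simp: d\<Phi>[OF z0] power2_eq_square algebra_simps)
  define v where "v = csqrt (cnj (deriv (deriv L) 0))"
  \<comment> \<open>Both \<open>v\<close> and \<open>-v\<close> are directions of convexity; the sign makes the first derivative nonnegative.\<close>
  define w where "w = (if Re (v * deriv L 0) \<ge> 0 then v else - v)"
  have w2: "w\<^sup>2 = cnj (deriv (deriv L) 0)" by (simp add: w_def v_def)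
  have w0: "w \<noteq> 0" using w2 \<beta> by auto
  have slope0: "Re (w * deriv L 0) \<ge> 0" by (simp add: w_def)
  have "w\<^sup>2 * deriv (deriv L) 0 = of_real ((norm (deriv (deriv L) 0))\<^sup>2)"
    unfolding w2 complex_norm_square by (simp add: mult.commute)
  then have curv0: "Re (w\<^sup>2 * deriv (deriv L) 0) > 0" using \<beta> by simp
  have "isCont (deriv (deriv L)) 0"
    using holomorphic_on_imp_continuous_on[OF hL2] z0 by (simp add: continuous_on_eq_continuous_at)
  then have "isCont (\<lambda>z. Re (w\<^sup>2 * deriv (deriv L) z)) 0"
    by (intro isCont_Re continuous_intros)
  from order_tendstoD(1)[OF this[unfolded isCont_def] curv0]
  obtain s where s: "s > 0" "\<And>z. z \<noteq> 0 \<Longrightarrow> norm z < s \<Longrightarrow> Re (w\<^sup>2 * deriv (deriv L) z) > 0"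
    unfolding eventually_at by (auto simp: dist_norm)
  have s': "Re (w\<^sup>2 * deriv (deriv L) z) > 0" if "norm z < s" for z
    using s(2)[of z] curv0 that by (cases "z = 0") auto
  define \<epsilon> where "\<epsilon> = min r s / (2 * norm w)"
  have \<epsilon>: "\<epsilon> > 0" using r(1) s(1) w0 by (simp add: \<epsilon>_def)
  have small: "norm (of_real t * w) < r" "norm (of_real t * w) < s" if "t \<in> {0..\<epsilon>}" for t :: real
  proof -
    have "norm (of_real t * w) \<le> \<epsilon> * norm w" using that by (auto simp: norm_mult intro!: mult_right_mono)
    also have "\<dots> = min r s / 2" using w0 by (simp add: \<epsilon>_def)
    finally show "norm (of_real t * w) < r" "norm (of_real t * w) < s" using r(1) s(1) by auto
  qed
  define g where "g t = Re (L (of_real t * w))" for t :: real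
  define g' where "g' t = Re (w * deriv L (of_real t * w))" for t :: real
  define g'' where "g'' t = Re (w\<^sup>2 * deriv (deriv L) (of_real t * w))" for t :: real
  have line: "((\<lambda>t. of_real t * w) has_vector_derivative w) (at t)" for t :: real
    by (auto intro!: derivative_eq_intros simp: has_vector_derivative_def scaleR_conv_of_real)
  have dg: "(g has_field_derivative g' t) (at t)" if "t \<in> {0..\<epsilon>}" for t
  proof -
    have "((\<lambda>t. L (of_real t * w)) has_vector_derivative (w * deriv L (of_real t * w))) (at t)"
      using field_vector_diff_chain_at[of "\<lambda>t. of_real t * w" w t L "deriv L (of_real t * w)"]
        L1[of "of_real t * w"] small[OF that] line
      by (simp add: o_def mult.commute)
    then show ?thesis unfolding g_def g'_def has_real_derivative_iff_has_vector_derivative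
      by (rule bounded_linear.has_vector_derivative[OF bounded_linear_Re])
  qed
  have dg': "(g' has_field_derivative g'' t) (at t)" if "t \<in> {0..\<epsilon>}" for t
  proof -
    have "((\<lambda>t. deriv L (of_real t * w)) has_vector_derivative (w * deriv (deriv L) (of_real t * w))) (at t)"
      using field_vector_diff_chain_at[of "\<lambda>t. of_real t * w" w t "deriv L" "deriv (deriv L) (of_real t * w)"]
        L2[of "of_real t * w"] small[OF that] line
      by (simp add: o_def mult.commute)
    from bounded_linear.has_vector_derivative[OF bounded_linear_Re has_vector_derivative_mult_right[OF this, of w]]
    show ?thesis unfolding g'_def g''_def has_real_derivative_iff_has_vector_derivative
      by (simp add: power2_eq_square mult.assoc)
  qed
  have g'_less: "g' x < g' y" if "x \<in> {0..\<epsilon>}" "y \<in> {0..\<epsilon>}" "x < y" for x y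
  proof (rule DERIV_pos_imp_increasing[OF that(3)])
    fix t assume "x \<le> t" "t \<le> y"
    with that have t: "t \<in> {0..\<epsilon>}" by auto
    show "\<exists>d. (g' has_real_derivative d) (at t) \<and> 0 < d"
      using dg'[OF t] s'[OF small(2)[OF t]] unfolding g''_def by blast
  qed
  have tangent: "g y > g x + g' x * (y - x)" if xy: "x \<in> {0..\<epsilon>}" "y \<in> {0..\<epsilon>}" "x \<noteq> y" for x y
  proof (cases "x < y")
    case True
    obtain \<xi> where \<xi>: "x < \<xi>" "\<xi> < y" "g y - g x = (y - x) * g' \<xi>"
      using MVT2[OF True, of g g'] dg xy by auto
    have "g' x * (y - x) < g' \<xi> * (y - x)"
      using g'_less[of x \<xi>] xy \<xi> True by (intro mult_strict_right_mono) auto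
    also have "\<dots> = g y - g x" unfolding \<xi>(3) by (rule mult.commute)
    finally show ?thesis by linarith
  next
    case False
    then have lt: "y < x" using xy by auto
    obtain \<xi> where \<xi>: "y < \<xi>" "\<xi> < x" "g x - g y = (x - y) * g' \<xi>"
      using MVT2[OF lt, of g g'] dg xy by auto
    have "g' \<xi> * (x - y) < g' x * (x - y)"
      using g'_less[of \<xi> x] xy \<xi> lt by (intro mult_strict_right_mono) auto
    also have "g' x * (x - y) = - (g' x * (y - x))" by (simp add: algebra_simps)
    also have "g' \<xi> * (x - y) = g x - g y" unfolding \<xi>(3) by (rule mult.commute)
    finally show ?thesis by linarith
  qed
  have norm_\<Phi>: "norm (\<Phi> (of_real t * w)) = exp (g t)" if "t \<in> {0..\<epsilon>}" for t
    using L(2)[of "of_real t * w"] small[OF that] by (metis g_def norm_exp_eq_Re mem_ball_0)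
  have g0: "g 0 = 0" using norm_\<Phi>[of 0] norm1 \<epsilon> by simp
  have "g t > 0" if "t \<in> {0<..\<epsilon>}" for t
  proof -
    have "g' 0 * t \<ge> 0" using slope0 that by (auto simp: g'_def)
    with tangent[of 0 t] that g0 show ?thesis by simp
  qed
  with w0 \<epsilon> g0 norm_\<Phi> tangent show ?thesis by blast
qed

text \<open>Compare \<open>g\<close> with its tangent at the mean: the linear terms cancel, and a point different
  from the mean makes the inequality strict.\<close>
lemma strict_Jensen_mean:
  fixes g g' :: "real \<Rightarrow> real"
  assumes tangent: "\<And>x y. x \<in> {0..\<epsilon>} \<Longrightarrow> y \<in> {0..\<epsilon>} \<Longrightarrow> x \<noteq> y \<Longrightarrow> g y > g x + g' x * (y - x)"
    and fin: "finite I" and x: "\<And>i. i \<in> I \<Longrightarrow> x i \<in> {0..\<epsilon>}"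
    and ne: "i \<in> I" "j \<in> I" "x i \<noteq> x j"
  shows "g ((\<Sum>i\<in>I. x i) / card I) < (\<Sum>i\<in>I. g (x i)) / card I"
proof -
  define \<mu> where "\<mu> = (\<Sum>i\<in>I. x i) / card I"
  have card: "card I > 0" using fin ne by (auto simp: card_gt_0_iff)
  have "(\<Sum>i\<in>I. x i) \<le> of_nat (card I) * \<epsilon>" using x by (intro sum_bounded_above) auto
  moreover have "(\<Sum>i\<in>I. x i) \<ge> 0" using x by (intro sum_nonneg) auto
  ultimately have \<mu>: "\<mu> \<in> {0..\<epsilon>}" using card by (simp add: \<mu>_def field_simps)
  have le: "g \<mu> + g' \<mu> * (x k - \<mu>) \<le> g (x k)" if "k \<in> I" for k
    using tangent[OF \<mu> x[OF that]] by (cases "x k = \<mu>") auto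
  from ne obtain k where k: "k \<in> I" "x k \<noteq> \<mu>" by metis
  have "(\<Sum>i\<in>I. g \<mu> + g' \<mu> * (x i - \<mu>)) < (\<Sum>i\<in>I. g (x i))"
    using fin le k tangent[OF \<mu> x[OF k(1)]] by (intro sum_strict_mono_ex1) auto
  also have "(\<Sum>i\<in>I. g \<mu> + g' \<mu> * (x i - \<mu>)) = card I * g \<mu> + g' \<mu> * ((\<Sum>i\<in>I. x i) - card I * \<mu>)"
    by (simp add: sum.distrib sum_distrib_left sum_subtractf algebra_simps)
  also have "(\<Sum>i\<in>I. x i) - card I * \<mu> = 0" using card by (simp add: \<mu>_def)
  finally show ?thesis using card unfolding \<mu>_def[symmetric] by (simp add: field_simps)
qed

lemma entire_poly_approx:
  assumes "f \<in> entire_functions" "e > 0"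
  shows "\<exists>p. near R e (poly p) f"
proof -
  define a where "a n = (deriv ^^ n) f 0 / fact n" for n
  have sums: "(\<lambda>n. a n * z ^ n) sums f z" for z
    using holomorphic_power_series[OF entire_holomorphic[OF assms(1)], of z 0 "norm z + 1"]
    by (simp add: a_def)
  have "conv_radius a = \<infinity>" by (intro conv_radius_inftyI'' sums_summable[OF sums])
  then have "R < conv_radius a" by simp
  from powser_uniform_limit[OF this, of 0]
  have "uniform_limit (cball 0 R) (\<lambda>n z. \<Sum>i<n. a i * z ^ i) f sequentially"
    using sums_unique[OF sums, symmetric] by simp
  from uniform_limit_eventually_near[OF this assms(2)]
  obtain n where n: "near R e (\<lambda>z. \<Sum>i<n. a i * z ^ i) f"
    using eventually_happens'[OF sequentially_bot] by blast
  have "poly (\<Sum>i<n. monom (a i) i) = (\<lambda>z. \<Sum>i<n. a i * z ^ i)"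
    by (auto simp: poly_sum poly_monom)
  with n show ?thesis by metis
qed

text \<open>Exponential sums with frequencies on an arbitrarily short segment at \<open>\<kappa>\<close> are dense. After
  division by \<open>exp (\<kappa> * z)\<close>, approximate by a polynomial in \<open>z\<close> and replace \<open>z\<close> by the difference
  quotient \<open>(exp (s * w * z) - 1) / (s * w)\<close>; the result is a polynomial in \<open>exp (s * w * z)\<close>.
  As the polynomial is chosen before \<open>s\<close>, its degree times \<open>s\<close> can be made as small as desired.\<close>
lemma entire_exponential_sum_approx:
  assumes f: "f \<in> entire_functions" and w: "w \<noteq> 0" and e: "e > 0" and \<eta>: "\<eta> > 0"
  shows "\<exists>N s c. s > 0 \<and> real N * s < \<eta> \<and>
    near R e (\<lambda>z. \<Sum>k\<le>N. c k * exp ((\<kappa> + of_real (real k * s) * w) * z)) f"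
proof -
  obtain M where M: "M > 0" "\<And>z. norm z \<le> R \<Longrightarrow> norm (exp (\<kappa> * z)) \<le> M"
    using entire_bounded_on_disc[OF entire_exp] by metis
  obtain p where p: "near R (e / (2 * M)) (poly p) (\<lambda>z. f z * exp (- \<kappa> * z))"
    using entire_poly_approx[OF entire_mult[OF f entire_exp]] e M(1) by (metis zero_less_divide_iff zero_less_mult_iff zero_less_numeral)
  have fp: "norm (exp (\<kappa> * z) * poly p z - f z) < e / 2" if "norm z \<le> R" for z
  proof -
    have "exp (\<kappa> * z) * poly p z - f z = exp (\<kappa> * z) * (poly p z - f z * exp (- \<kappa> * z))"
      by (simp add: algebra_simps exp_minus_inverse flip: exp_add)
    also have "norm \<dots> < M * (e / (2 * M))"
      unfolding norm_mult using M(1) M(2)[OF that] p that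
      by (intro mult_le_less_imp_less) (auto simp: near_def)
    finally show ?thesis using M(1) by simp
  qed
  define q where "q \<zeta> = (if \<zeta> = 0 then 1 else (exp \<zeta> - 1) / \<zeta>)" for \<zeta> :: complex
  have "continuous_on UNIV q"
    unfolding continuous_on_eq_continuous_at[OF open_UNIV]
  proof
    fix \<zeta> :: complex
    show "isCont q \<zeta>"
    proof (cases "\<zeta> = 0")
      case True
      have "((\<lambda>\<zeta>. (exp \<zeta> - 1) / \<zeta>) \<longlongrightarrow> 1) (at (0 :: complex))"
        using DERIV_exp[of "0 :: complex"] by (simp add: DERIV_def)
      then have "(q \<longlongrightarrow> 1) (at 0)"
        by (rule Lim_transform_eventually) (auto simp: q_def eventually_at intro: exI[of _ 1])
      then show ?thesis by (simp add: isCont_def q_def True)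
    next
      case False
      have "isCont (\<lambda>\<zeta>. (exp \<zeta> - 1) / \<zeta>) \<zeta>" using False by (intro continuous_intros)
      moreover have "\<forall>\<^sub>F x in nhds \<zeta>. q x = (exp x - 1) / x"
        using t1_space_nhds[OF False] by eventually_elim (simp add: q_def)
      ultimately show ?thesis using isCont_cong by metis
    qed
  qed
  then have cq: "continuous_on S (\<lambda>x. q (h x))" if "continuous_on S h" for S and h :: "real \<times> complex \<Rightarrow> complex"
    using continuous_on_compose2[OF _ that] by blast
  \<comment> \<open>The approximant as a function of both \<open>s\<close> and \<open>z\<close>; uniform continuity makes it close to its
     value at \<open>s = 0\<close>, uniformly in \<open>z\<close>.\<close>
  define G where "G = (\<lambda>(s :: real, z). exp (\<kappa> * z) * poly p (z * q (of_real s * w * z)))"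
  have "continuous_on ({0..1} \<times> cball 0 R) G"
    unfolding G_def case_prod_beta by (intro continuous_intros cq)
  then have "uniformly_continuous_on ({0..1} \<times> cball 0 R) G"
    by (intro compact_uniformly_continuous compact_Times compact_Icc compact_cball)
  then obtain d where d: "d > 0"
    "\<And>x y. x \<in> {0..1} \<times> cball 0 R \<Longrightarrow> y \<in> {0..1} \<times> cball 0 R \<Longrightarrow> dist y x < d \<Longrightarrow> dist (G y) (G x) < e / 2"
    unfolding uniformly_continuous_on_def using e by (metis half_gt_zero)
  define N where "N = degree p"
  define s where "s = min 1 (min (d / 2) (\<eta> / (real N + 1) / 2))"
  have s: "s > 0" "s \<le> 1" "s < d" using d(1) \<eta> by (auto simp: s_def)
  have "real N * s \<le> real N * (\<eta> / (real N + 1) / 2)" by (intro mult_left_mono) (auto simp: s_def)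
  also have "\<dots> < \<eta>" using \<eta> by (simp add: field_simps add_nonneg_pos)
  finally have Ns: "real N * s < \<eta>" .
  define b where "b = of_real s * w"
  have b: "b \<noteq> 0" using s w by (simp add: b_def)
  define P where "P = pcompose p [:- (1 / b), 1 / b:]"
  have degP: "degree P = N" unfolding P_def N_def by (simp add: degree_pcompose b)
  have Gs: "G (s, z) = (\<Sum>k\<le>N. coeff P k * exp ((\<kappa> + of_real (real k * s) * w) * z))" for z
  proof -
    have "z * q (b * z) = (exp (b * z) - 1) / b" using b by (auto simp: q_def)
    also have "\<dots> = poly [:- (1 / b), 1 / b:] (exp (b * z))" by (simp add: field_simps b)
    finally have "poly p (z * q (b * z)) = poly P (exp (b * z))" by (simp add: P_def poly_pcompose)
    also have "\<dots> = (\<Sum>k\<le>N. coeff P k * exp (b * z) ^ k)" by (simp add: poly_altdef degP)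
    finally have "G (s, z) = (\<Sum>k\<le>N. coeff P k * (exp (\<kappa> * z) * exp (b * z) ^ k))"
      by (simp add: G_def b_def sum_distrib_left mult_ac)
    also have "(\<lambda>k. exp (\<kappa> * z) * exp (b * z) ^ k) = (\<lambda>k. exp ((\<kappa> + of_real (real k * s) * w) * z))"
      by (simp add: fun_eq_iff b_def exp_add algebra_simps flip: exp_of_nat_mult)
    finally show ?thesis .
  qed
  have "near R e (\<lambda>z. G (s, z)) f"
    unfolding near_def
  proof (intro allI impI)
    fix z :: complex assume z: "norm z \<le> R"
    have "dist (s, z) (0, z) < d" using s by (simp add: dist_Pair_Pair)
    then have "dist (G (s, z)) (G (0, z)) < e / 2" using s z by (intro d(2)) auto
    moreover have "G (0, z) = exp (\<kappa> * z) * poly p z" by (simp add: G_def q_def)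
    ultimately show "norm (G (s, z) - f z) < e"
      using norm_diff_triangle_less[of "G (s, z)" "G (0, z)" "e / 2" "f z" "e / 2"] fp[OF z]
      by (simp add: dist_norm)
  qed
  then show ?thesis unfolding Gs using s Ns by blast
qed

section \<open>Powers of exponential sums under iteration\<close>

lemma power_exponential_sum:
  fixes c \<nu> :: "'x \<Rightarrow> complex"
  assumes "finite X"
  shows "(\<Sum>x\<in>X. c x * exp (\<nu> x * z)) ^ j
    = (\<Sum>\<phi>\<in>PiE {..<j} (\<lambda>_. X). (\<Prod>i<j. c (\<phi> i)) * exp ((\<Sum>i<j. \<nu> (\<phi> i)) * z))"
proof -
  have "(\<Sum>x\<in>X. c x * exp (\<nu> x * z)) ^ j = (\<Prod>i<j. \<Sum>x\<in>X. c x * exp (\<nu> x * z))" by simp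
  also have "\<dots> = (\<Sum>\<phi>\<in>PiE {..<j} (\<lambda>_. X). \<Prod>i<j. c (\<phi> i) * exp (\<nu> (\<phi> i) * z))"
    by (rule prod_sum_PiE) (use assms in auto)
  also have "\<dots> = (\<Sum>\<phi>\<in>PiE {..<j} (\<lambda>_. X). (\<Prod>i<j. c (\<phi> i)) * exp ((\<Sum>i<j. \<nu> (\<phi> i)) * z))"
    by (simp add: prod.distrib exp_sum sum_distrib_right)
  finally show ?thesis .
qed

lemma exponential_sum_limit:
  fixes c \<theta> \<nu> :: "'x \<Rightarrow> complex"
  assumes X: "finite X" "E \<subseteq> X"
    and one: "\<And>x. x \<in> E \<Longrightarrow> \<theta> x = 1" and less: "\<And>x. x \<in> X \<Longrightarrow> x \<notin> E \<Longrightarrow> norm (\<theta> x) < 1"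
  shows "uniform_limit (cball 0 R) (\<lambda>q z. \<Sum>x\<in>X. c x * \<theta> x ^ q * exp (\<nu> x * z))
    (\<lambda>z. \<Sum>x\<in>E. c x * exp (\<nu> x * z)) sequentially"
proof -
  have single: "uniform_limit (cball 0 R) (\<lambda>q z. c x * \<theta> x ^ q * exp (\<nu> x * z))
      (\<lambda>z. (if x \<in> E then c x else 0) * exp (\<nu> x * z)) sequentially" if "x \<in> X" for x
  proof (rule uniform_lim_mult)
    have "(\<lambda>q. c x * \<theta> x ^ q) \<longlonglongrightarrow> (if x \<in> E then c x else 0)"
      using one[of x] tendsto_mult_right_zero[OF LIMSEQ_power_zero[OF less[OF that]], of "c x"] by auto
    then show "uniform_limit (cball 0 R) (\<lambda>q z. c x * \<theta> x ^ q) (\<lambda>z. if x \<in> E then c x else 0) sequentially"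
      unfolding uniform_limit_iff tendsto_iff by auto
    show "bounded ((\<lambda>z. exp (\<nu> x * z)) ` cball 0 R)"
      by (intro compact_imp_bounded compact_continuous_image continuous_intros compact_cball)
  qed (auto intro!: uniform_limit_const intro: bounded_subset[of "{if x \<in> E then c x else 0}"])
  have "uniform_limit (cball 0 R) (\<lambda>q z. \<Sum>x\<in>X. c x * \<theta> x ^ q * exp (\<nu> x * z))
      (\<lambda>z. \<Sum>x\<in>X. (if x \<in> E then c x else 0) * exp (\<nu> x * z)) sequentially"
    using X(1) single
  proof (induction X rule: finite_induct)
    case (insert x Y)
    show ?case unfolding sum.insert[OF insert.hyps]
      by (intro uniform_limit_add insert.IH insert.prems) auto
  qed (simp add: uniform_limit_const)
  also have "(\<lambda>z. \<Sum>x\<in>X. (if x \<in> E then c x else 0) * exp (\<nu> x * z)) = (\<lambda>z. \<Sum>x\<in>E. c x * exp (\<nu> x * z))"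
    by (intro ext sum.mono_neutral_cong_right X) auto
  finally show ?thesis .
qed

context convolution_operator
begin

text \<open>Exponentials are eigenvectors of \<open>\<Phi>(D)\<close>. In the expansion of the \<open>j\<close>-th power of an exponential
  sum, the product selected by \<open>\<phi>\<close> therefore gets, under the \<open>q\<close>-th iterate, the \<open>q\<close>-th power of the
  multiplier \<open>(\<Prod>i<j. r (\<phi> i)) * \<Phi> (\<Sum>i<j. \<nu> (\<phi> i))\<close>. As \<open>q\<close> grows, exactly the products with
  multiplier \<open>1\<close> survive. The coefficients shrink at the rates \<open>r\<close> in order to produce this.\<close>
lemma Tn_power_exponential_sum_limit:
  fixes b r \<nu> :: "'x \<Rightarrow> complex"
  assumes X: "finite X" and E: "E \<subseteq> PiE {..<j} (\<lambda>_. X)"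
    and one: "\<And>\<phi>. \<phi> \<in> E \<Longrightarrow> (\<Prod>i<j. r (\<phi> i)) * \<Phi> (\<Sum>i<j. \<nu> (\<phi> i)) = 1"
    and less: "\<And>\<phi>. \<phi> \<in> PiE {..<j} (\<lambda>_. X) \<Longrightarrow> \<phi> \<notin> E \<Longrightarrow>
      norm ((\<Prod>i<j. r (\<phi> i)) * \<Phi> (\<Sum>i<j. \<nu> (\<phi> i))) < 1"
  shows "uniform_limit (cball 0 R)
    (\<lambda>q. (T ^^ q) (\<lambda>z. (\<Sum>x\<in>X. b x * r x ^ q * exp (\<nu> x * z)) ^ j))
    (\<lambda>z. \<Sum>\<phi>\<in>E. (\<Prod>i<j. b (\<phi> i)) * exp ((\<Sum>i<j. \<nu> (\<phi> i)) * z)) sequentially"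
proof -
  have "(T ^^ q) (\<lambda>z. (\<Sum>x\<in>X. b x * r x ^ q * exp (\<nu> x * z)) ^ j)
      = (\<lambda>z. \<Sum>\<phi>\<in>PiE {..<j} (\<lambda>_. X). (\<Prod>i<j. b (\<phi> i)) *
          ((\<Prod>i<j. r (\<phi> i)) * \<Phi> (\<Sum>i<j. \<nu> (\<phi> i))) ^ q * exp ((\<Sum>i<j. \<nu> (\<phi> i)) * z))" for q
    unfolding power_exponential_sum[OF X]
    by (subst Tn_sum, rule entire_exp)
      (simp add: Tn_exp prod.distrib power_mult_distrib prod_power_distrib mult.assoc)
  then show ?thesis
    by (simp only:) (intro exponential_sum_limit finite_PiE X E one less; simp)
qed

text \<open>The function \<open>f\<close> is an exponential sum with two groups of frequencies. The first group,
  close to \<open>a\<close>, approximates \<open>f0\<close>. The second group consists of \<open>t k / m * w\<close>, where \<open>h\<close> is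
  approximated by the sum of the \<open>\<gamma> k * exp (t k * w * z)\<close>; its coefficients are \<open>m\<close>-th roots of
  \<open>\<gamma> k / \<Phi> (t k * w) ^ q\<close>, which tend to \<open>0\<close> because \<open>\<bar>\<Phi> (t * w)\<bar> > 1\<close>.

  In a \<open>j\<close>-fold product with \<open>p \<ge> 1\<close> factors of the first group, the total frequency is close to \<open>p * a\<close>,
  where \<open>\<bar>\<Phi>\<bar> < 1\<close>. A product of second group factors has a multiplier of modulus
  \<open>exp (g (mean) - mean of g)\<close>, where the mean is taken over \<open>m\<close> points, namely the \<open>j\<close> values \<open>t k\<close> and
  \<open>m - j\<close> zeros; by strict convexity this is less than \<open>1\<close> unless \<open>j = m\<close> and all factors
  agree. The exceptions are the powers \<open>(b k * exp (t k / m * w * z)) ^ m\<close>, which \<open>T ^^ q\<close> maps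
  exactly to the summands of the approximation to \<open>h\<close>.\<close>
lemma powers_near_targets:
  assumes norm1: "norm (\<Phi> 0) = 1"
    and curv: "deriv (deriv \<Phi>) 0 * \<Phi> 0 \<noteq> (deriv \<Phi> 0)\<^sup>2"
    and m: "m \<ge> 1" and a: "\<And>j. j \<in> {1..m} \<Longrightarrow> norm (\<Phi> (of_nat j * a)) < 1"
    and f0: "f0 \<in> entire_functions" and h: "h \<in> entire_functions" and e: "e > 0"
  shows "\<exists>f \<in> entire_functions. \<exists>q. near R e f f0 \<and>
    (\<forall>j\<in>{1..<m}. near R e ((T ^^ q) (\<lambda>z. f z ^ j)) (\<lambda>z. 0)) \<and>
    near R e ((T ^^ q) (\<lambda>z. f z ^ m)) h"
proof -
  obtain w \<epsilon> g g' where w: "w \<noteq> 0" and \<epsilon>: "\<epsilon> > 0" and g0: "g 0 = (0 :: real)"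
    and gpos: "\<And>t. t \<in> {0<..\<epsilon>} \<Longrightarrow> g t > 0"
    and norm_\<Phi>: "\<And>t. t \<in> {0..\<epsilon>} \<Longrightarrow> norm (\<Phi> (of_real t * w)) = exp (g t)"
    and tangent: "\<And>x y. x \<in> {0..\<epsilon>} \<Longrightarrow> y \<in> {0..\<epsilon>} \<Longrightarrow> x \<noteq> y \<Longrightarrow> g y > g x + g' x * (y - x :: real)"
    using log_strictly_convex_direction[OF \<Phi>_entire norm1 curv] by metis
  have "\<forall>\<^sub>F u in nhds 0. \<forall>j\<in>{1..m}. norm (\<Phi> (of_nat j * a + u)) < 1"
  proof (rule eventually_ball_finite)
    show "\<forall>j\<in>{1..m}. \<forall>\<^sub>F u in nhds 0. norm (\<Phi> (of_nat j * a + u)) < 1"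
    proof
      fix j assume j: "j \<in> {1..m}"
      have "continuous_on UNIV (\<lambda>u. norm (\<Phi> (of_nat j * a + u)))"
        by (intro continuous_intros continuous_on_compose2[OF entire_continuous[OF \<Phi>_entire]]) auto
      then have "isCont (\<lambda>u. norm (\<Phi> (of_nat j * a + u))) 0"
        by (simp add: continuous_on_eq_continuous_at)
      then have "((\<lambda>u. norm (\<Phi> (of_nat j * a + u))) \<longlongrightarrow> norm (\<Phi> (of_nat j * a))) (nhds 0)"
        using tendsto_at_iff_tendsto_nhds[of "\<lambda>u. norm (\<Phi> (of_nat j * a + u))" 0]
        by (simp add: isCont_def)
      then show "\<forall>\<^sub>F u in nhds 0. norm (\<Phi> (of_nat j * a + u)) < 1"
        using a[OF j] by (intro order_tendstoD)
    qed
  qed simp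
  then obtain \<delta> where \<delta>: "\<delta> > 0"
    "\<And>u j. norm u < \<delta> \<Longrightarrow> j \<in> {1..m} \<Longrightarrow> norm (\<Phi> (of_nat j * a + u)) < 1"
    unfolding eventually_nhds_metric by auto
  have nw: "norm w > 0" using w by simp
  define \<tau> where "\<tau> = min \<epsilon> (\<delta> / (2 * norm w))"
  have \<tau>: "\<tau> > 0" "\<tau> \<le> \<epsilon>" "\<tau> * norm w \<le> \<delta> / 2"
    using \<epsilon> \<delta>(1) nw by (auto simp: \<tau>_def min_def field_simps)
  obtain N1 s1 \<alpha> where s1: "s1 > 0" "real N1 * s1 < \<delta> / (2 * norm w * real m)"
    and A: "near R (e/2) (\<lambda>z. \<Sum>k\<le>N1. \<alpha> k * exp ((a + of_real (real k * s1) * w) * z)) f0"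
    using entire_exponential_sum_approx[OF f0 w, of "e/2" "\<delta> / (2 * norm w * real m)" R a] e \<delta>(1) nw m by auto
  obtain N2 s2 \<gamma> where s2: "s2 > 0" "real N2 * s2 < \<tau> / 2"
    and H: "near R (e/2) (\<lambda>z. \<Sum>k\<le>N2. \<gamma> k * exp ((of_real (\<tau>/2) * w + of_real (real k * s2) * w) * z)) h"
    using entire_exponential_sum_approx[OF h w, of "e/2" "\<tau>/2" R "of_real (\<tau>/2) * w"] e \<tau>(1) by auto
  define t where "t k = \<tau> / 2 + real k * s2" for k :: nat
  have t: "t k \<in> {0<..\<epsilon>}" "t k < \<tau>" if "k \<le> N2" for k
  proof -
    have "real k * s2 \<le> real N2 * s2" using that s2(1) by (intro mult_right_mono) auto
    then show "t k < \<tau>" using s2 unfolding t_def by linarith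
    then show "t k \<in> {0<..\<epsilon>}" using \<tau> s2(1) by (auto simp: t_def add_pos_nonneg)
  qed
  have t_inj: "t k = t l \<longleftrightarrow> k = l" for k l using s2(1) by (simp add: t_def)
  have \<Phi>t: "norm (\<Phi> (of_real (t k) * w)) = exp (g (t k))" if "k \<le> N2" for k
    using norm_\<Phi>[of "t k"] t[OF that] by simp
  have root: "\<exists>y :: complex. y ^ m = x" for x
    using m exists_complex_root[of m x] by auto
  then obtain rt where root: "\<And>x :: complex. rt x ^ m = x" by metis
  define \<rho> where "\<rho> k = rt (1 / \<Phi> (of_real (t k) * w))" for k
  have norm_\<rho>: "norm (\<rho> k) = exp (- g (t k) / m)" if "k \<le> N2" for k
  proof (rule power_eq_imp_eq_base)
    have "norm (\<rho> k) ^ m = exp (- g (t k))"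
      by (simp add: \<rho>_def root norm_divide \<Phi>t[OF that] exp_minus inverse_eq_divide flip: norm_power)
    also have "\<dots> = exp (- g (t k) / m) ^ m" using m by (simp flip: exp_of_nat_mult)
    finally show "norm (\<rho> k) ^ m = exp (- g (t k) / m) ^ m" .
  qed (use m in auto)
  have \<rho>_less: "norm (\<rho> k) < 1" if "k \<le> N2" for k
    using gpos[OF t(1)[OF that]] m by (simp add: norm_\<rho>[OF that])
  \<comment> \<open>\<open>Inl\<close> indexes the frequencies near \<open>a\<close> with constant coefficients, \<open>Inr\<close> the small frequencies.\<close>
  define X where "X = {..N1} <+> {..N2}"
  define b where "b = case_sum \<alpha> (\<lambda>k. rt (\<gamma> k))"
  define r where "r = case_sum (\<lambda>_ :: nat. 1) \<rho>"
  define \<nu> where "\<nu> = case_sum (\<lambda>k. a + of_real (real k * s1) * w) (\<lambda>k. of_real (t k / m) * w)"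
  define F where "F q z = (\<Sum>x\<in>X. b x * r x ^ q * exp (\<nu> x * z))" for q :: nat and z
  have X: "finite X" by (simp add: X_def)
  have r_le: "norm (r x) \<le> 1" if "x \<in> X" for x
    using that \<rho>_less by (fastforce simp: X_def r_def intro: less_imp_le)
  have F_entire: "F q \<in> entire_functions" for q
    unfolding F_def[abs_def] by (intro entire_sum entire_mult entire_const entire_exp)

  have mixed: "norm ((\<Prod>i<j. r (\<phi> i)) * \<Phi> (\<Sum>i<j. \<nu> (\<phi> i))) < 1"
    if j: "j \<le> m" and \<phi>: "\<phi> \<in> PiE {..<j} (\<lambda>_. X)" and i: "i < j" "isl (\<phi> i)" for j \<phi> i
  proof -
    have \<phi>X: "\<phi> i \<in> X" if "i < j" for i using \<phi> that by auto
    define u where "u x = \<nu> x - (if isl x then a else 0)" for x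
    have u: "norm (u x) \<le> \<delta> / (2 * m)" if "x \<in> X" for x
    proof (cases x)
      case (Inl k)
      with that have k: "k \<le> N1" by (auto simp: X_def)
      have "norm (u x) = (real k * s1) * norm w" using Inl s1(1) by (simp add: u_def \<nu>_def norm_mult)
      also have "\<dots> \<le> (real N1 * s1) * norm w" using k s1(1) by (intro mult_right_mono) auto
      also have "\<dots> \<le> \<delta> / (2 * norm w * real m) * norm w" using s1(2) by (intro mult_right_mono) auto
      also have "\<dots> = \<delta> / (2 * m)" using w by simp
      finally show ?thesis .
    next
      case (Inr k)
      with that have k: "k \<le> N2" by (auto simp: X_def)
      have "norm (u x) = t k * norm w / m" using Inr t(1)[OF k] by (simp add: u_def \<nu>_def norm_mult norm_divide)
      also have "\<dots> \<le> \<tau> * norm w / m" using t[OF k] by (intro divide_right_mono mult_right_mono) auto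
      also have "\<dots> \<le> (\<delta> / 2) / m" using \<tau> by (intro divide_right_mono) auto
      finally show ?thesis by simp
    qed
    define p where "p = card {i \<in> {..<j}. isl (\<phi> i)}"
    have "p \<le> card {..<j}" unfolding p_def by (intro card_mono) auto
    moreover have "p > 0" unfolding p_def using i by (auto simp: card_gt_0_iff)
    ultimately have p: "p \<in> {1..m}" using j by auto
    have "(\<Sum>i<j. if isl (\<phi> i) then a else 0) = of_nat p * a"
      by (simp add: p_def sum.If_cases Int_def)
    then have sum_\<nu>: "(\<Sum>i<j. \<nu> (\<phi> i)) = of_nat p * a + (\<Sum>i<j. u (\<phi> i))"
      by (simp add: u_def sum_subtractf)
    have "norm (\<Sum>i<j. u (\<phi> i)) \<le> (\<Sum>i<j. \<delta> / (2 * m))"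
      by (intro sum_norm_le u \<phi>X) simp
    also have "\<dots> \<le> (\<Sum>i<m. \<delta> / (2 * m))" using j \<delta>(1) by (intro sum_mono2) auto
    also have "\<dots> < \<delta>" using m \<delta>(1) by simp
    finally have "norm (\<Phi> (\<Sum>i<j. \<nu> (\<phi> i))) < 1" unfolding sum_\<nu> using \<delta>(2) p by blast
    moreover have "norm (\<Prod>i<j. r (\<phi> i)) \<le> 1"
      unfolding prod_norm[symmetric] by (intro prod_le_1) (auto intro: r_le \<phi>X)
    ultimately show ?thesis unfolding norm_mult
      using mult_left_le_one_le[of "norm (\<Phi> (\<Sum>i<j. \<nu> (\<phi> i)))" "norm (\<Prod>i<j. r (\<phi> i))"] by simp
  qed

  \<comment> \<open>Products of fewer than \<open>m\<close> small frequencies are padded with the frequency \<open>0\<close>, where \<open>g\<close> vanishes.\<close>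
  have pure: "norm ((\<Prod>i<j. r (\<phi> i)) * \<Phi> (\<Sum>i<j. \<nu> (\<phi> i))) < 1"
    if j: "1 \<le> j" "j \<le> m" and \<phi>: "\<And>i. i < j \<Longrightarrow> \<phi> i = Inr (\<kappa> i)" "\<And>i. i < j \<Longrightarrow> \<kappa> i \<le> N2"
      and ne: "j < m \<or> (\<exists>i<j. \<exists>i'<j. \<kappa> i \<noteq> \<kappa> i')" for j \<phi> \<kappa>
  proof -
    define x where "x i = (if i < j then t (\<kappa> i) else 0)" for i
    have x: "x i \<in> {0..\<epsilon>}" for i using t(1)[OF \<phi>(2), of i] \<epsilon> by (auto simp: x_def)
    have "\<exists>i\<in>{..<m}. \<exists>i'\<in>{..<m}. x i \<noteq> x i'"
      using ne
    proof
      assume "j < m"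
      moreover have "x 0 \<noteq> x j" using j t(1)[OF \<phi>(2), of 0] by (auto simp: x_def)
      ultimately show ?thesis using m by (intro bexI[of _ 0] bexI[of _ j]) auto
    next
      assume "\<exists>i<j. \<exists>i'<j. \<kappa> i \<noteq> \<kappa> i'"
      then obtain i i' where "i < j" "i' < j" "\<kappa> i \<noteq> \<kappa> i'" by blast
      then show ?thesis using j by (intro bexI[of _ i] bexI[of _ i']) (auto simp: x_def t_inj)
    qed
    then have "g ((\<Sum>i<m. x i) / m) < (\<Sum>i<m. g (x i)) / m"
      using strict_Jensen_mean[of \<epsilon> g g' "{..<m}" x] tangent x by auto
    moreover have "(\<Sum>i<m. g (x i)) = (\<Sum>i<j. g (t (\<kappa> i)))"
      using j g0 by (intro sum.mono_neutral_cong_right) (auto simp: x_def)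
    moreover have sum_x: "(\<Sum>i<m. x i) = (\<Sum>i<j. t (\<kappa> i))"
      using j by (intro sum.mono_neutral_cong_right) (auto simp: x_def)
    ultimately have jensen: "g ((\<Sum>i<j. t (\<kappa> i)) / m) < (\<Sum>i<j. g (t (\<kappa> i))) / m" by simp
    have "(\<Sum>i<m. x i) \<le> of_nat (card {..<m}) * \<epsilon>" using x by (intro sum_bounded_above) auto
    moreover have "(\<Sum>i<m. x i) \<ge> 0" using x by (intro sum_nonneg) auto
    ultimately have mean: "(\<Sum>i<j. t (\<kappa> i)) / m \<in> {0..\<epsilon>}" using m sum_x by (simp add: field_simps)
    have "(\<Sum>i<j. \<nu> (\<phi> i)) = of_real ((\<Sum>i<j. t (\<kappa> i)) / m) * w"
      by (simp add: \<phi> \<nu>_def sum_divide_distrib sum_distrib_right)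
    then have "norm (\<Phi> (\<Sum>i<j. \<nu> (\<phi> i))) = exp (g ((\<Sum>i<j. t (\<kappa> i)) / m))"
      using norm_\<Phi>[OF mean] by simp
    moreover have "norm (\<Prod>i<j. r (\<phi> i)) = exp (- ((\<Sum>i<j. g (t (\<kappa> i))) / m))"
      using norm_\<rho> \<phi> by (simp add: r_def sum_negf sum_divide_distrib flip: prod_norm exp_sum)
    ultimately show ?thesis using jensen by (simp add: norm_mult flip: exp_add)
  qed

  have small_index: "\<phi> i = Inr (projr (\<phi> i))" "projr (\<phi> i) \<le> N2"
    if "\<phi> \<in> PiE {..<j} (\<lambda>_. X)" "\<not> (\<exists>i<j. isl (\<phi> i))" "i < j" for \<phi> i j
  proof -
    have "\<phi> i \<in> X" "\<not> isl (\<phi> i)" using that by auto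
    then show "\<phi> i = Inr (projr (\<phi> i))" "projr (\<phi> i) \<le> N2"
      by (cases "\<phi> i"; auto simp: X_def)+
  qed

  have lower: "uniform_limit (cball 0 R) (\<lambda>q. (T ^^ q) (\<lambda>z. F q z ^ j)) (\<lambda>z. 0) sequentially"
    if j: "j \<in> {1..<m}" for j
  proof -
    have "norm ((\<Prod>i<j. r (\<phi> i)) * \<Phi> (\<Sum>i<j. \<nu> (\<phi> i))) < 1" if \<phi>: "\<phi> \<in> PiE {..<j} (\<lambda>_. X)" for \<phi>
    proof (cases "\<exists>i<j. isl (\<phi> i)")
      case True
      then show ?thesis using mixed[OF _ \<phi>] j by auto
    next
      case False
      then show ?thesis
        using pure[of j \<phi> "\<lambda>i. projr (\<phi> i)"] small_index[OF \<phi>] j by auto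
    qed
    then show ?thesis
      using Tn_power_exponential_sum_limit[OF X, where E = "{}" and j = j and r = r and \<nu> = \<nu> and R = R and b = b] by (simp add: F_def)
  qed

  have top: "uniform_limit (cball 0 R) (\<lambda>q. (T ^^ q) (\<lambda>z. F q z ^ m))
    (\<lambda>z. \<Sum>k\<le>N2. \<gamma> k * exp (of_real (t k) * w * z)) sequentially"
  proof -
    define C where "C k = (\<lambda>i\<in>{..<m}. Inr k :: nat + nat)" for k
    have C: "C k i = Inr k" if "i < m" for k i using that by (simp add: C_def)
    define E where "E = C ` {..N2}"
    have inj: "inj_on C {..N2}" using C[of 0] m by (intro inj_onI) (metis Inr_inject less_le_trans zero_less_one)
    have sum_C: "(\<Sum>i<m. \<nu> (C k i)) = of_real (t k) * w" for k using m by (simp add: C \<nu>_def)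
    have less: "norm ((\<Prod>i<m. r (\<phi> i)) * \<Phi> (\<Sum>i<m. \<nu> (\<phi> i))) < 1"
      if \<phi>: "\<phi> \<in> PiE {..<m} (\<lambda>_. X)" "\<phi> \<notin> E" for \<phi>
    proof (cases "\<exists>i<m. isl (\<phi> i)")
      case True
      then show ?thesis using mixed[OF _ \<phi>(1)] by auto
    next
      case False
      note Inr = small_index[OF \<phi>(1) False]
      have "\<exists>i<m. \<exists>i'<m. projr (\<phi> i) \<noteq> projr (\<phi> i')"
      proof (rule ccontr)
        assume "\<not> (\<exists>i<m. \<exists>i'<m. projr (\<phi> i) \<noteq> projr (\<phi> i'))"
        moreover have "0 < m" using m by simp
        ultimately have "projr (\<phi> i) = projr (\<phi> 0)" if "i < m" for i using that by blast
        then have "\<phi> i = C (projr (\<phi> 0)) i" if "i \<in> {..<m}" for i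
          using C[of i] Inr(1)[of i] that by (metis lessThan_iff)
        with \<phi>(1) have "\<phi> = C (projr (\<phi> 0))"
          by (intro extensionalityI[of \<phi> "{..<m}"]) (simp_all only: PiE_def Int_iff C_def restrict_extensional)
        moreover have "projr (\<phi> 0) \<le> N2" using Inr(2)[of 0] m by simp
        ultimately show False using \<phi>(2) unfolding E_def by blast
      qed
      then show ?thesis by (intro pure[of m \<phi> "\<lambda>i. projr (\<phi> i)"] Inr m disjI2 order_refl)
    qed
    have one: "(\<Prod>i<m. r (\<phi> i)) * \<Phi> (\<Sum>i<m. \<nu> (\<phi> i)) = 1" if "\<phi> \<in> E" for \<phi>
    proof -
      from that obtain k where k: "k \<le> N2" "\<phi> = C k" by (auto simp: E_def)
      have "(\<Prod>i<m. r (\<phi> i)) = 1 / \<Phi> (of_real (t k) * w)" by (simp add: k C r_def \<rho>_def root)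
      moreover have "\<Phi> (of_real (t k) * w) \<noteq> 0" using \<Phi>t[OF k(1)] by auto
      ultimately show ?thesis by (simp add: k sum_C)
    qed
    have "E \<subseteq> PiE {..<m} (\<lambda>_. X)" by (auto simp: E_def C_def X_def split: if_splits)
    from Tn_power_exponential_sum_limit[where r = r and \<nu> = \<nu> and b = b and R = R, OF X this one less]
    have "uniform_limit (cball 0 R) (\<lambda>q. (T ^^ q) (\<lambda>z. F q z ^ m))
      (\<lambda>z. \<Sum>\<phi>\<in>E. (\<Prod>i<m. b (\<phi> i)) * exp ((\<Sum>i<m. \<nu> (\<phi> i)) * z)) sequentially"
      unfolding F_def .
    also have "(\<lambda>z. \<Sum>\<phi>\<in>E. (\<Prod>i<m. b (\<phi> i)) * exp ((\<Sum>i<m. \<nu> (\<phi> i)) * z))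
        = (\<lambda>z. \<Sum>k\<le>N2. \<gamma> k * exp (of_real (t k) * w * z))"
      unfolding E_def sum.reindex[OF inj] by (simp add: sum_C) (simp add: C b_def root)
    finally show ?thesis .
  qed

  have start: "uniform_limit (cball 0 R) F
      (\<lambda>z. \<Sum>k\<le>N1. \<alpha> k * exp ((a + of_real (real k * s1) * w) * z)) sequentially"
  proof -
    have "uniform_limit (cball 0 R) F (\<lambda>z. \<Sum>x\<in>Inl ` {..N1}. b x * exp (\<nu> x * z)) sequentially"
      unfolding F_def by (rule exponential_sum_limit[OF X]) (auto simp: X_def r_def \<rho>_less)
    then show ?thesis by (simp add: sum.reindex b_def \<nu>_def)
  qed

  have "\<forall>\<^sub>F q in sequentially. near R (e/2) (F q)
      (\<lambda>z. \<Sum>k\<le>N1. \<alpha> k * exp ((a + of_real (real k * s1) * w) * z))"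
    using uniform_limit_eventually_near[OF start] e by simp
  moreover have "\<forall>\<^sub>F q in sequentially. near R (e/2) ((T ^^ q) (\<lambda>z. F q z ^ m))
      (\<lambda>z. \<Sum>k\<le>N2. \<gamma> k * exp (of_real (t k) * w * z))"
    using uniform_limit_eventually_near[OF top] e by simp
  moreover have "\<forall>\<^sub>F q in sequentially. \<forall>j\<in>{1..<m}. near R e ((T ^^ q) (\<lambda>z. F q z ^ j)) (\<lambda>z. 0)"
    using uniform_limit_eventually_near[OF lower e] by (intro eventually_ball_finite) auto
  ultimately have "\<forall>\<^sub>F q in sequentially. near R e (F q) f0 \<and>
      (\<forall>j\<in>{1..<m}. near R e ((T ^^ q) (\<lambda>z. F q z ^ j)) (\<lambda>z. 0)) \<and>
      near R e ((T ^^ q) (\<lambda>z. F q z ^ m)) h"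
  proof eventually_elim
    case (elim q)
    have "near R e (F q) f0" using near_triangle[OF elim(1) A] by simp
    moreover have "near R e ((T ^^ q) (\<lambda>z. F q z ^ m)) h"
      using near_triangle[OF elim(2), of "e/2" h] H by (simp add: t_def distrib_right)
    ultimately show ?case using elim(3) by blast
  qed
  then obtain q where "near R e (F q) f0 \<and>
      (\<forall>j\<in>{1..<m}. near R e ((T ^^ q) (\<lambda>z. F q z ^ j)) (\<lambda>z. 0)) \<and>
      near R e ((T ^^ q) (\<lambda>z. F q z ^ m)) h"
    using eventually_happens'[OF sequentially_bot] by blast
  with F_entire show ?thesis by blast
qed

end

section \<open>The hypercyclic algebra\<close>

lemma countable_dense_entire:
  "\<exists>d :: nat \<Rightarrow> complex \<Rightarrow> complex. (\<forall>k. d k \<in> entire_functions) \<and>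
     (\<forall>f \<in> entire_functions. \<forall>R e. e > 0 \<longrightarrow> (\<exists>k. near R e (d k) f))"
proof -
  obtain C :: "complex set" where C: "countable C" "\<And>X. open X \<Longrightarrow> X \<noteq> {} \<Longrightarrow> \<exists>c\<in>C. c \<in> X"
    by (rule countable_dense_setE) blast
  define p :: "complex list \<Rightarrow> complex \<Rightarrow> complex" where "p xs = (\<lambda>z. \<Sum>i<length xs. xs ! i * z ^ i)" for xs
  have dense: "\<exists>xs\<in>lists C. near R e (p xs) f" if f: "f \<in> entire_functions" and e: "e > 0" for f R e
  proof -
    obtain P where P: "near R (e/2) (poly P) f" using entire_poly_approx[OF f] e half_gt_zero by blast
    define n where "n = Suc (degree P)"
    define M where "M = (\<Sum>i<n. max R 0 ^ i)"
    have "max R 0 ^ 0 \<le> M" unfolding M_def n_def by (rule member_le_sum) auto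
    then have M: "M > 0" by simp
    define \<epsilon> where "\<epsilon> = e / (4 * M)"
    have \<epsilon>: "\<epsilon> > 0" using e M by (simp add: \<epsilon>_def)
    have "\<exists>c\<in>C. c \<in> ball (coeff P i) \<epsilon>" for i using \<epsilon> by (intro C(2)) auto
    then obtain c where c: "\<And>i. c i \<in> C" "\<And>i. norm (c i - coeff P i) < \<epsilon>"
      by (metis dist_commute dist_norm mem_ball)
    define xs where "xs = map c [0..<n]"
    have "near R (e/2) (p xs) (poly P)"
      unfolding near_def
    proof (intro allI impI)
      fix z :: complex assume z: "norm z \<le> R"
      have "p xs z - poly P z = (\<Sum>i<n. (c i - coeff P i) * z ^ i)"
        by (simp add: p_def xs_def poly_altdef n_def lessThan_Suc_atMost sum_subtractf left_diff_distrib
              del: sum.lessThan_Suc upt_Suc)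
      also have "norm \<dots> \<le> (\<Sum>i<n. \<epsilon> * max R 0 ^ i)"
      proof (intro sum_norm_le)
        show "norm ((c i - coeff P i) * z ^ i) \<le> \<epsilon> * max R 0 ^ i" for i
          unfolding norm_mult norm_power
          using c(2)[of i] z \<epsilon> by (intro mult_mono power_mono) auto
      qed
      also have "\<dots> = \<epsilon> * M" by (simp add: M_def sum_distrib_left)
      also have "\<dots> = e / 4" using M by (simp add: \<epsilon>_def)
      finally show "norm (p xs z - poly P z) < e / 2" using e by simp
    qed
    from near_triangle[OF this P] have "near R e (p xs) f" by simp
    moreover have "xs \<in> lists C" using c(1) by (auto simp: xs_def)
    ultimately show ?thesis by blast
  qed
  have "lists C \<noteq> {}" by auto
  have "countable (lists C)" by (rule countable_lists[OF C(1)])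
  then have range: "range (from_nat_into (lists C)) = lists C"
    using \<open>lists C \<noteq> {}\<close> by (rule range_from_nat_into[rotated])
  have "p xs \<in> entire_functions" for xs
    unfolding p_def by (auto simp: entire_functions_def intro!: holomorphic_intros)
  moreover have "\<exists>k. near R e (p (from_nat_into (lists C) k)) f"
    if "f \<in> entire_functions" "e > 0" for f R e
    using dense[OF that, of R] range by (metis rangeE)
  ultimately show ?thesis by (intro exI[of _ "\<lambda>k. p (from_nat_into (lists C) k)"]) blast
qed

context convolution_operator
begin

text \<open>For fixed data \<open>m\<close>, target and precision, the functions \<open>f\<close> with a suitable \<open>q\<close> contain a dense
  open set. Countably many targets and precisions suffice, so a generic \<open>f\<close> satisfies all of them.\<close>
lemma exists_generator_with_dense_powers:
  assumes norm1: "norm (\<Phi> 0) = 1"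
    and curv: "deriv (deriv \<Phi>) 0 * \<Phi> 0 \<noteq> (deriv \<Phi> 0)\<^sup>2"
    and AP: "\<And>m. \<exists>a. \<forall>j\<in>{1..m}. norm (\<Phi> (of_nat j * a)) < 1"
  shows "\<exists>f \<in> entire_functions. \<forall>m h R e. h \<in> entire_functions \<longrightarrow> e > 0 \<longrightarrow>
    (\<exists>q. (\<forall>j\<in>{1..m}. near R e ((T ^^ q) (\<lambda>z. f z ^ j)) (\<lambda>z. 0)) \<and>
      near R e ((T ^^ q) (\<lambda>z. f z ^ Suc m)) h)"
proof -
  obtain d :: "nat \<Rightarrow> complex \<Rightarrow> complex" where d: "\<And>k. d k \<in> entire_functions"
    "\<And>f R e. f \<in> entire_functions \<Longrightarrow> e > 0 \<Longrightarrow> \<exists>k. near R e (d k) f"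
    using countable_dense_entire by blast
  define G where "G = (\<lambda>(m, k, N :: nat). {f. \<exists>q.
    (\<forall>j\<in>{1..m}. near N (1 / (real N + 1)) ((T ^^ q) (\<lambda>z. f z ^ j)) (\<lambda>z. 0)) \<and>
    near N (1 / (real N + 1)) ((T ^^ q) (\<lambda>z. f z ^ Suc m)) (d k)})"
  have "\<exists>f \<in> entire_functions. \<forall>n. f \<in> G (from_nat n)"
  proof (rule Baire_entire)
    fix n f0 and R e :: real assume f0: "f0 \<in> entire_functions" and e: "e > 0"
    obtain m k N :: nat where n: "from_nat n = (m, k, N)" by (metis prod_cases3)
    define \<eta> where "\<eta> = 1 / (real N + 1)"
    have \<eta>: "\<eta> > 0" by (simp add: \<eta>_def)
    obtain a where a: "\<And>j. j \<in> {1..Suc m} \<Longrightarrow> norm (\<Phi> (of_nat j * a)) < 1" using AP[of "Suc m"] by blast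
    have "min e (\<eta>/2) > 0" using e \<eta> by simp
    from powers_near_targets[OF norm1 curv _ a f0 d(1)[of k] this, where R = "max R N" and m = "Suc m"]
    obtain f q where f: "f \<in> entire_functions" "near (max R N) (min e (\<eta>/2)) f f0"
      "\<forall>j\<in>{1..<Suc m}. near (max R N) (min e (\<eta>/2)) ((T ^^ q) (\<lambda>z. f z ^ j)) (\<lambda>z. 0)"
      "near (max R N) (min e (\<eta>/2)) ((T ^^ q) (\<lambda>z. f z ^ Suc m)) (d k)" by fastforce
    have "\<forall>j. \<exists>R' \<delta>. \<delta> > 0 \<and> (\<forall>g \<in> entire_functions. near R' \<delta> g f \<longrightarrow>
        near N (\<eta>/2) ((T ^^ q) (\<lambda>z. g z ^ j)) ((T ^^ q) (\<lambda>z. f z ^ j)))"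
      using Tn_power_continuous[OF f(1)] \<eta> by (intro allI) simp
    then obtain R' \<delta> where cont: "\<And>j. \<delta> j > 0" "\<And>j g. g \<in> entire_functions \<Longrightarrow> near (R' j) (\<delta> j) g f \<Longrightarrow>
        near N (\<eta>/2) ((T ^^ q) (\<lambda>z. g z ^ j)) ((T ^^ q) (\<lambda>z. f z ^ j))" by metis
    define S where "S = Max (R' ` {..Suc m})"
    define \<delta>0 where "\<delta>0 = Min (\<delta> ` {..Suc m})"
    have \<delta>0: "\<delta>0 > 0" unfolding \<delta>0_def using cont(1) by (subst Min_gr_iff) auto
    have "g \<in> G (m, k, N)" if g: "g \<in> entire_functions" "near S \<delta>0 g f" for g
    proof -
      have close: "near N (\<eta>/2) ((T ^^ q) (\<lambda>z. g z ^ j)) ((T ^^ q) (\<lambda>z. f z ^ j))" if "j \<le> Suc m" for j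
        by (rule cont(2)[OF g(1) near_mono[OF g(2)]]) (use that in \<open>auto simp: S_def \<delta>0_def\<close>)
      have "near N \<eta> ((T ^^ q) (\<lambda>z. g z ^ j)) (\<lambda>z. 0)" if "j \<in> {1..m}" for j
      proof -
        have "near N (\<eta>/2) ((T ^^ q) (\<lambda>z. f z ^ j)) (\<lambda>z. 0)"
          by (rule near_mono[OF bspec[OF f(3)]]) (use that in auto)
        from near_triangle[OF close this] that show ?thesis by simp
      qed
      moreover have "near N \<eta> ((T ^^ q) (\<lambda>z. g z ^ Suc m)) (d k)"
      proof -
        have "near N (\<eta>/2) ((T ^^ q) (\<lambda>z. f z ^ Suc m)) (d k)"
          by (rule near_mono[OF f(4)]) auto
        from near_triangle[OF close[OF order_refl] this] show ?thesis by simp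
      qed
      ultimately show ?thesis unfolding G_def \<eta>_def by blast
    qed
    moreover have "near R e f f0" by (rule near_mono[OF f(2)]) auto
    ultimately show "\<exists>g\<in>entire_functions. near R e g f0 \<and>
       (\<exists>R' d. d > 0 \<and> (\<forall>h\<in>entire_functions. near R' d h g \<longrightarrow> h \<in> G (from_nat n)))"
      using f(1) \<delta>0 unfolding n by blast
  qed
  then obtain f where f: "f \<in> entire_functions" "\<And>n. f \<in> G (from_nat n)" by blast
  have G: "f \<in> G x" for x using f(2)[of "to_nat x"] by simp
  have "\<exists>q. (\<forall>j\<in>{1..m}. near R e ((T ^^ q) (\<lambda>z. f z ^ j)) (\<lambda>z. 0)) \<and>
      near R e ((T ^^ q) (\<lambda>z. f z ^ Suc m)) h" if h: "h \<in> entire_functions" and e: "e > 0" for m h R e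
  proof -
    obtain N :: nat where N: "real N \<ge> max R (2 / e)" using real_arch_simple by blast
    have \<eta>: "1 / (real N + 1) \<le> e / 2"
    proof -
      have "2 \<le> e * real N" using N e by (simp add: field_simps)
      then show ?thesis using e by (simp add: field_simps)
    qed
    obtain k where k: "near N (e/2) (d k) h" using d(2)[OF h, of "e/2" N] e by auto
    obtain q where q: "\<forall>j\<in>{1..m}. near N (1 / (real N + 1)) ((T ^^ q) (\<lambda>z. f z ^ j)) (\<lambda>z. 0)"
      "near N (1 / (real N + 1)) ((T ^^ q) (\<lambda>z. f z ^ Suc m)) (d k)"
      using G[of "(m, k, N)"] unfolding G_def by auto
    have "near R e ((T ^^ q) (\<lambda>z. f z ^ j)) (\<lambda>z. 0)" if "j \<in> {1..m}" for j
      by (rule near_mono[OF bspec[OF q(1) that]]) (use N \<eta> e in auto)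
    moreover have "near N (e/2 + e/2) ((T ^^ q) (\<lambda>z. f z ^ Suc m)) h"
      by (rule near_triangle[OF near_mono[OF q(2)] k]) (use \<eta> in auto)
    then have "near R e ((T ^^ q) (\<lambda>z. f z ^ Suc m)) h"
      by (rule near_mono) (use N in auto)
    ultimately show ?thesis by blast
  qed
  with f(1) show ?thesis by blast
qed

text \<open>A suitable iterate makes the lower powers of \<open>f\<close> small, so only the leading term of \<open>P(f)\<close>
  matters: aim the top power at \<open>h\<close> divided by the leading coefficient.\<close>
lemma polynomial_orbit_dense:
  assumes f: "f \<in> entire_functions"
    and targets: "\<And>m h R e. h \<in> entire_functions \<Longrightarrow> e > 0 \<Longrightarrow>
      \<exists>q. (\<forall>j\<in>{1..m}. near R e ((T ^^ q) (\<lambda>z. f z ^ j)) (\<lambda>z. 0)) \<and>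
        near R e ((T ^^ q) (\<lambda>z. f z ^ Suc m)) h"
    and P: "P \<noteq> 0" "coeff P 0 = 0" and h: "h \<in> entire_functions" and e: "e > 0"
  shows "\<exists>q. near R e ((T ^^ q) (\<lambda>z. poly P (f z))) h"
proof -
  have "degree P \<noteq> 0" using P by (metis leading_coeff_0_iff)
  then obtain m where m: "degree P = Suc m" by (cases "degree P") auto
  define c where "c = coeff P"
  have c: "c (Suc m) \<noteq> 0" using P m by (metis c_def leading_coeff_0_iff)
  define S where "S = (\<Sum>j\<in>{1..Suc m}. norm (c j))"
  have S_eq: "S = (\<Sum>j\<in>{1..m}. norm (c j)) + norm (c (Suc m))" by (simp add: S_def)
  have S: "S > 0" unfolding S_eq using c by (intro add_nonneg_pos sum_nonneg) auto
  define \<eta> where "\<eta> = e / S"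
  have \<eta>: "\<eta> > 0" using e S by (simp add: \<eta>_def)
  have "(\<lambda>z. inverse (c (Suc m)) * h z) \<in> entire_functions" by (intro entire_mult entire_const h)
  from targets[OF this \<eta>, of m R] obtain q where
    q: "\<And>j. j \<in> {1..m} \<Longrightarrow> near R \<eta> ((T ^^ q) (\<lambda>z. f z ^ j)) (\<lambda>z. 0)"
      "near R \<eta> ((T ^^ q) (\<lambda>z. f z ^ Suc m)) (\<lambda>z. inverse (c (Suc m)) * h z)" by blast
  have "poly P (f z) = (\<Sum>j\<in>{1..Suc m}. c j * f z ^ j)" for z
    unfolding poly_altdef m c_def[symmetric]
    by (rule sum.mono_neutral_right) (auto simp: c_def P(2) not_less_eq_eq)
  then have TP: "(T ^^ q) (\<lambda>z. poly P (f z)) = (\<lambda>z. \<Sum>j\<in>{1..Suc m}. c j * (T ^^ q) (\<lambda>z. f z ^ j) z)"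
    using Tn_sum[of "{1..Suc m}" "\<lambda>j z. f z ^ j" q c] entire_power[OF f] by simp
  have "near R e ((T ^^ q) (\<lambda>z. poly P (f z))) h"
    unfolding near_def
  proof (intro allI impI)
    fix z :: complex assume z: "norm z \<le> R"
    let ?low = "\<Sum>j\<in>{1..m}. c j * (T ^^ q) (\<lambda>z. f z ^ j) z"
    let ?top = "(T ^^ q) (\<lambda>z. f z ^ Suc m) z - inverse (c (Suc m)) * h z"
    have "norm ((T ^^ q) (\<lambda>z. f z ^ j) z) \<le> \<eta>" if "j \<in> {1..m}" for j
      using q(1)[OF that] z by (simp add: near_def less_imp_le)
    then have low: "norm ?low \<le> (\<Sum>j\<in>{1..m}. norm (c j) * \<eta>)"
      by (intro sum_norm_le) (simp add: norm_mult mult_left_mono)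
    have top: "norm (c (Suc m) * ?top) < norm (c (Suc m)) * \<eta>"
      unfolding norm_mult using q(2) z c by (intro mult_strict_left_mono) (auto simp: near_def)
    have "(T ^^ q) (\<lambda>z. poly P (f z)) z - h z = ?low + c (Suc m) * ?top"
      unfolding TP using c by (simp add: right_diff_distrib del: power_Suc)
    also have "norm \<dots> < (\<Sum>j\<in>{1..m}. norm (c j) * \<eta>) + norm (c (Suc m)) * \<eta>"
      by (rule le_less_trans[OF norm_triangle_ineq add_le_less_mono[OF low top]])
    also have "\<dots> = S * \<eta>" by (simp only: S_eq sum_distrib_right distrib_right)
    also have "\<dots> = e" using S by (simp add: \<eta>_def)
    finally show "norm ((T ^^ q) (\<lambda>z. poly P (f z)) z - h z) < e" .
  qed
  then show ?thesis by blast
qed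

text \<open>The algebra generated by \<open>f\<close> without unit, which consists of the \<open>P(f)\<close> with \<open>P(0) = 0\<close>.\<close>
lemma supports_hypercyclic_algebraI:
  assumes f: "f \<in> entire_functions"
    and dense: "\<And>P h R e. P \<noteq> 0 \<Longrightarrow> coeff P 0 = 0 \<Longrightarrow> h \<in> entire_functions \<Longrightarrow> e > 0 \<Longrightarrow>
      \<exists>q. near R e ((T ^^ q) (\<lambda>z. poly P (f z))) h"
  shows "supports_hypercyclic_algebra T"
proof -
  define \<A> where "\<A> = (\<lambda>P z. poly P (f z)) ` {P. coeff P 0 = 0}"
  have poly_entire: "(\<lambda>z. poly P (f z)) \<in> entire_functions" for P
    using f unfolding entire_functions_def
    by (auto simp: poly_altdef intro!: holomorphic_intros)
  have hyp: "hypercyclic_vector entire_topology T (\<lambda>z. poly P (f z))" if "P \<noteq> 0" "coeff P 0 = 0" for P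
    by (intro hypercyclic_vectorI poly_entire T_entire dense that)
  have "subalgebra_entire \<A>"
    unfolding subalgebra_entire_def
  proof (intro conjI ballI allI)
    show "\<A> \<subseteq> entire_functions" using poly_entire by (auto simp: \<A>_def)
    show "(\<lambda>z. 0) \<in> \<A>" unfolding \<A>_def by (rule image_eqI[of _ _ 0]) auto
  next
    fix g1 g2 assume "g1 \<in> \<A>" "g2 \<in> \<A>"
    then obtain P1 P2 where "g1 = (\<lambda>z. poly P1 (f z))" "coeff P1 0 = 0" "g2 = (\<lambda>z. poly P2 (f z))" "coeff P2 0 = 0"
      by (auto simp: \<A>_def)
    then show "(\<lambda>z. g1 z + g2 z) \<in> \<A>" "(\<lambda>z. g1 z * g2 z) \<in> \<A>"
      unfolding \<A>_def
      by (auto intro: image_eqI[of _ _ "P1 + P2"], auto intro!: image_eqI[of _ _ "P1 * P2"] simp: coeff_mult)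
  next
    fix c g assume "g \<in> \<A>"
    then obtain P where "g = (\<lambda>z. poly P (f z))" "coeff P 0 = 0" by (auto simp: \<A>_def)
    then show "(\<lambda>z. c * g z) \<in> \<A>" unfolding \<A>_def by (intro image_eqI[of _ _ "smult c P"]) auto
  qed
  moreover have "\<A> \<noteq> {\<lambda>z. 0}"
  proof
    assume "\<A> = {\<lambda>z. 0}"
    moreover have "f \<in> \<A>" unfolding \<A>_def by (intro image_eqI[of _ _ "[:0, 1:]"]) auto
    ultimately have "f = (\<lambda>z. 0)" by simp
    moreover have "(T ^^ q) (\<lambda>z. 0) = (\<lambda>z. 0)" for q using Tn_cmult[OF f, of q 0] by simp
    ultimately show False
      using dense[of "[:0, 1:]" "\<lambda>z. 1" 1 0] by (auto simp: near_def entire_const)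
  qed
  moreover have "hypercyclic_vector entire_topology T g" if "g \<in> \<A> - {\<lambda>z. 0}" for g
  proof -
    from that obtain P where P: "g = (\<lambda>z. poly P (f z))" "coeff P 0 = 0" by (auto simp: \<A>_def)
    then have "P \<noteq> 0" using that by auto
    with hyp P show ?thesis by simp
  qed
  ultimately show ?thesis unfolding supports_hypercyclic_algebra_def hypercyclic_algebra_def by blast
qed

end

theorem theorem1p3:
  fixes \<Phi> :: "complex \<Rightarrow> complex"
  assumes "\<Phi> \<in> entire_functions"
    and "exponential_type \<Phi>"
    and "norm (\<Phi> 0) = 1"
    and "deriv (deriv \<Phi>) 0 * \<Phi> 0 \<noteq> (deriv \<Phi> 0)\<^sup>2"
    and "\<forall>m :: nat. \<exists>a :: complex. a \<noteq> 0 \<and> (\<forall>j\<in>{1..m}. norm (\<Phi> (of_nat j * a)) < 1)"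
  shows "supports_hypercyclic_algebra (diff_op \<Phi>)"
proof -
  interpret convolution_operator \<Phi> by unfold_locales (use assms in auto)
  obtain f where f: "f \<in> entire_functions" "\<And>m h R e. h \<in> entire_functions \<Longrightarrow> e > 0 \<Longrightarrow>
    \<exists>q. (\<forall>j\<in>{1..m}. near R e ((T ^^ q) (\<lambda>z. f z ^ j)) (\<lambda>z. 0)) \<and>
      near R e ((T ^^ q) (\<lambda>z. f z ^ Suc m)) h"
    using exists_generator_with_dense_powers[OF assms(3,4)] assms(5) by blast
  show ?thesis
    by (rule supports_hypercyclic_algebraI[OF f(1)]) (rule polynomial_orbit_dense[OF f(1)], use f(2) in auto)
qed

end
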